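(* Let $N\ge 3$. The monoid $\operatorname{NDPF}^{(1)}_N$ of affine non-decreasing parking functions is $\mathcal{J}$-trivial, and it is isomorphic to the quotient of the $0$-Hecke monoid $H_0(\tilde S_N)$ by the relations $\pi_j\pi_{j+1}\pi_j=\pi_j\pi_{j+1}$ for all $j\in\mathbb{Z}/N\mathbb{Z}$. Moreover, each fiber of the quotient map $H_0(\tilde S_N)\to H_0(\tilde S_N)/(\pi_j\pi_{j+1}\pi_j=\pi_j\pi_{j+1})$, viewed as a set of affine permutations via $w\mapsto\pi_w$, contains a unique $[321]$-avoiding affine permutation.
   Context: The affine symmetric group $\tilde S_N$ is the group of bijections $\sigma:\mathbb{Z}\to\mathbb{Z}$ with $\sigma(i+N)=\sigma(i)+N$ for all $i$ and $\sum_{i=1}^N\sigma(i)=\binom{N+1}{2}$. It is generated by $s_0,\dots,s_{N-1}$, where $s_i$ exchanges $j$ and $j+1$ for every $j\equiv i \pmod N$; indices are taken mod $N$, with relations $s_i^2=1$, $s_is_j=s_js_i$ when $i,j$ are not adjacent mod $N$, $s_is_{i+1}s_i=s_{i+1}s_is_{i+1}$. The $0$-Hecke monoid $H_0(\tilde S_N)$ is generated by $\pi_i$ ($i\in\mathbb{Z}/N$) with $\pi_i^2=\pi_i$ and the same commutation and braid relations; its elements are $\pi_w=\pi_{i_1}\cdots\pi_{i_k}$ for reduced words $w=s_{i_1}\cdots s_{i_k}$, in bijection with $\tilde S_N$. An affine permutation $x$ contains $[321]$ if there are integers $a<b<c$ with $x(a)>x(b)>x(c)$; otherwise it is $[321]$-avoiding.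 $\operatorname{NDPF}^{(1)}_N$ is the set of functions $f:\mathbb{Z}\to\mathbb{Z}$ that are regressive ($f(i)\le i$), order preserving ($i\le j\Rightarrow f(i)\le f(j)$) and skew periodic ($f(i+N)=f(i)+N$), excluding the shift functions $i\mapsto i-t$ for $t\neq 0$; it is a monoid under composition. A monoid $M$ is $\mathcal J$-trivial if $MfM=MgM$ implies $f=g$. *)

theory Defs
  imports Main
begin

definition affine_perm :: "nat \<Rightarrow> (int \<Rightarrow> int) \<Rightarrow> bool" where
  "affine_perm N w \<longleftrightarrow> bij w \<and> (\<forall>i. w (i + int N) = w i + int N) \<and>
     (\<Sum>i = 1..int N. w i) = int N * (int N + 1) div 2"

definition s_gen :: "nat \<Rightarrow> nat \<Rightarrow> int \<Rightarrow> int" where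
  "s_gen N i j = (if j mod int N = int i then j + 1
                  else if j mod int N = int ((i + 1) mod N) then j - 1 else j)"

text \<open>Words over the alphabet Z/N, represented by letters 0..N-1.\<close>
definition is_word :: "nat \<Rightarrow> nat list \<Rightarrow> bool" where
  "is_word N u \<longleftrightarrow> set u \<subseteq> {..<N}"

definition word_perm :: "nat \<Rightarrow> nat list \<Rightarrow> int \<Rightarrow> int" where
  "word_perm N u = foldr (\<lambda>i f. s_gen N i \<circ> f) u id"

definition reduced_word :: "nat \<Rightarrow> (int \<Rightarrow> int) \<Rightarrow> nat list \<Rightarrow> bool" where
  "reduced_word N w r \<longleftrightarrow> is_word N r \<and> word_perm N r = w \<and>
     (\<forall>r'. is_word N r' \<and> word_perm N r' = w \<longrightarrow> length r \<le> length r')"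

definition avoids_321 :: "(int \<Rightarrow> int) \<Rightarrow> bool" where
  "avoids_321 x \<longleftrightarrow> \<not> (\<exists>a b c. a < b \<and> b < c \<and> x a > x b \<and> x b > x c)"

inductive cong_closure :: "('a list \<Rightarrow> 'a list \<Rightarrow> bool) \<Rightarrow> 'a list \<Rightarrow> 'a list \<Rightarrow> bool"
  for R where
  base: "R l r \<Longrightarrow> cong_closure R (u @ l @ v) (u @ r @ v)"
| refl: "cong_closure R u u"
| sym: "cong_closure R u v \<Longrightarrow> cong_closure R v u"
| trans: "cong_closure R u v \<Longrightarrow> cong_closure R v w \<Longrightarrow> cong_closure R u w"

definition adjacent_mod :: "nat \<Rightarrow> nat \<Rightarrow> nat \<Rightarrow> bool" where
  "adjacent_mod N i j \<longleftrightarrow> j = (i + 1) mod N \<or> i = (j + 1) mod N"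

definition hecke_rel :: "nat \<Rightarrow> nat list \<Rightarrow> nat list \<Rightarrow> bool" where
  "hecke_rel N l r \<longleftrightarrow>
     (\<exists>i<N. l = [i, i] \<and> r = [i]) \<or>
     (\<exists>i<N. \<exists>j<N. \<not> adjacent_mod N i j \<and> l = [i, j] \<and> r = [j, i]) \<or>
     (\<exists>i<N. l = [i, (i + 1) mod N, i] \<and> r = [(i + 1) mod N, i, (i + 1) mod N])"

definition quot_rel :: "nat \<Rightarrow> nat list \<Rightarrow> nat list \<Rightarrow> bool" where
  "quot_rel N l r \<longleftrightarrow> hecke_rel N l r \<or>
     (\<exists>j<N. l = [j, (j + 1) mod N, j] \<and> r = [j, (j + 1) mod N])"

abbreviation hecke_cong :: "nat \<Rightarrow> nat list \<Rightarrow> nat list \<Rightarrow> bool" where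
  "hecke_cong N \<equiv> cong_closure (hecke_rel N)"

abbreviation quot_cong :: "nat \<Rightarrow> nat list \<Rightarrow> nat list \<Rightarrow> bool" where
  "quot_cong N \<equiv> cong_closure (quot_rel N)"

definition NDPF :: "nat \<Rightarrow> (int \<Rightarrow> int) set" where
  "NDPF N = {f. (\<forall>i. f i \<le> i) \<and> (\<forall>i j. i \<le> j \<longrightarrow> f i \<le> f j) \<and>
                (\<forall>i. f (i + int N) = f i + int N) \<and>
                \<not> (\<exists>t. t \<noteq> 0 \<and> f = (\<lambda>i. i - t))}"

definition J_trivial :: "('a \<Rightarrow> 'a) set \<Rightarrow> bool" where
  "J_trivial M \<longleftrightarrow> (\<forall>f\<in>M. \<forall>g\<in>M.
     {a \<circ> f \<circ> b | a b. a \<in> M \<and> b \<in> M} = {a \<circ> g \<circ> b | a b. a \<in> M \<and> b \<in> M} \<longrightarrow> f = g)"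

end

(*
  The generator pi_i acts on the integers by sending every k congruent to i + 1 to k - 1 and fixing
  the rest; this respects the relations of the quotient. If r is a reduced word of w, the resulting
  function is the suffix minimum f(i) = min {w(k) | k >= i}. A right multiplication by pi_i that
  does not change f is already trivial in the quotient, and otherwise a product with a
  [321]-avoiding reduced word is again one, or can be rewritten to one that is no longer. So every
  class contains a [321]-avoiding permutation, and such a permutation is determined by its suffix
  minima: it agrees with f where f jumps and is increasing on the remaining positions. This gives
  injectivity and uniqueness at once; surjectivity is by induction on the sum of i - f(i) over
  a period.
*)

theory Submission
  imports Defs
begin

text \<open>Fibers are described through reduced words, so two reduced words of one permutation must
  be shown congruent. Length is therefore controlled by \<open>asc_word\<close>, a local condition
  on ascents, and each descent is realised by a congruence of words; the comparison with
  \<open>reduced_word\<close> comes afterwards. Letters are appended on the right. For permutations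
  and functions alike this precomposes, hence acts on positions, which is what makes suffix minima
  compatible with both actions. The orientation of the additional relation fits:
  \<open>lower N a\<close> after \<open>lower N (a + 1)\<close> carries a + 2 down to a, the
  opposite order only to a + 1. Removing a [321] pattern peels off letters and then extends shorter
  words again; this recursion closes up only because the replacement is no longer than the word
  before the extension. For uniqueness, knowing that a permutation increases on an infinite set of
  positions still leaves a shift undetermined. Counting over a finite interval shows that such a
  shift goes the same way everywhere, and the prescribed sum over a period excludes it.\<close>

text \<open>Generators are indexed by arbitrary integers, the letter being the residue; this
  avoids all wrap-around cases at the letter N - 1.\<close>
definition letter :: "nat \<Rightarrow> int \<Rightarrow> nat" where
  "letter N a = nat (a mod int N)"

definition aff_swap :: "nat \<Rightarrow> int \<Rightarrow> int \<Rightarrow> int" where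
  "aff_swap N a j = (if int N dvd j - a then j + 1 else if int N dvd j - a - 1 then j - 1 else j)"

definition lower :: "nat \<Rightarrow> int \<Rightarrow> int \<Rightarrow> int" where
  "lower N a k = (if int N dvd k - a - 1 then k - 1 else k)"

definition word_ndpf :: "nat \<Rightarrow> nat list \<Rightarrow> int \<Rightarrow> int" where
  "word_ndpf N u = foldr (\<lambda>i f. lower N (int i) \<circ> f) u id"

definition skew :: "nat \<Rightarrow> (int \<Rightarrow> int) \<Rightarrow> bool" where
  "skew N w \<longleftrightarrow> (\<forall>i. w (i + int N) = w i + int N)"

text \<open>The length-increasing words. They are exactly the reduced ones, see
  \<open>reduced_word_iff_asc_word\<close> below.\<close>
inductive asc_word :: "nat \<Rightarrow> nat list \<Rightarrow> bool" for N where
  Nil: "asc_word N []"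
| snoc: "asc_word N u \<Longrightarrow> i < N \<Longrightarrow> word_perm N u (int i) < word_perm N u (int i + 1)
    \<Longrightarrow> asc_word N (u @ [i])"

text \<open>Stated as lower bound plus attainment, because the minimum is over an infinite set of
  values. The two clauses determine f from w.\<close>

definition suffix_min :: "(int \<Rightarrow> int) \<Rightarrow> (int \<Rightarrow> int) \<Rightarrow> bool" where
  "suffix_min w f \<longleftrightarrow> (\<forall>i k. i \<le> k \<longrightarrow> f i \<le> w k) \<and> (\<forall>i. \<exists>k\<ge>i. w k = f i)"

section \<open>Skew-periodic functions and congruences modulo N\<close>

lemma dvd_close: "m dvd x \<Longrightarrow> m dvd y \<Longrightarrow> \<bar>x - y\<bar> < m \<Longrightarrow> x = (y::int)"
  using dvd_imp_le_int[of "x - y" m] dvd_diff[of m x y] by fastforce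

lemma skew_add_mult_nat: "skew N w \<Longrightarrow> w (i + int k * int N) = w i + int k * int N"
proof (induction k)
  case (Suc k)
  have "w (i + int k * int N + int N) = w (i + int k * int N) + int N"
    using Suc.prems unfolding skew_def by blast
  then show ?case using Suc by (simp add: algebra_simps)
qed simp

lemma skew_add_mult:
  assumes "skew N w" shows "w (i + k * int N) = w i + k * int N"
proof (cases "k \<ge> 0")
  case True
  then show ?thesis using skew_add_mult_nat[OF assms, of i "nat k"] by simp
next
  case False
  then show ?thesis using skew_add_mult_nat[OF assms, of "i + k * int N" "nat (- k)"] by simp
qed

lemma skew_dvd:
  assumes "skew N w" "int N dvd j - a" shows "w j = w a + (j - a)"
proof -
  obtain k where k: "j - a = int N * k" using assms(2) by blast
  then have "j = a + k * int N" by (simp add: algebra_simps)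
  then show ?thesis using skew_add_mult[OF assms(1), of a k] by simp
qed

lemma skew_comp: "skew N f \<Longrightarrow> skew N g \<Longrightarrow> skew N (f \<circ> g)"
  by (simp add: skew_def)

lemma dvd_add_self: "int N dvd i + int N - a \<longleftrightarrow> int N dvd i - a"
  using dvd_add_left_iff[of "int N" "int N" "i - a"] by (simp add: algebra_simps)

lemma dvd_add_self': "int N dvd i + int N - a - 1 \<longleftrightarrow> int N dvd i - a - 1"
  using dvd_add_self[of N i "a + 1"] by (simp add: algebra_simps)

lemma skew_aff_swap: "skew N (aff_swap N a)"
  unfolding skew_def aff_swap_def by (simp add: dvd_add_self dvd_add_self')

lemma skew_lower: "skew N (lower N a)"
  unfolding skew_def lower_def by (simp add: dvd_add_self')

lemma dvd_diff_swap: "int N dvd a - b \<Longrightarrow> int N dvd j - a \<longleftrightarrow> int N dvd j - b"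
  using dvd_add_left_iff[of "int N" "a - b" "j - a"] by simp

lemma dvd_diff_swap1: "int N dvd a - b \<Longrightarrow> int N dvd j - a - 1 \<longleftrightarrow> int N dvd j - b - 1"
  using dvd_diff_swap[of N a b "j - 1"] by (simp add: algebra_simps)

lemma aff_swap_cong: "int N dvd a - b \<Longrightarrow> aff_swap N a = aff_swap N b"
  unfolding aff_swap_def fun_eq_iff by (simp add: dvd_diff_swap dvd_diff_swap1)

lemma lower_cong: "int N dvd a - b \<Longrightarrow> lower N a = lower N b"
  unfolding lower_def fun_eq_iff by (simp add: dvd_diff_swap1)

section \<open>Letters as residue classes\<close>

lemma letter_eq_iff: "N > 0 \<Longrightarrow> letter N a = letter N b \<longleftrightarrow> int N dvd a - b"
  unfolding letter_def by (simp add: mod_eq_dvd_iff nat_eq_iff)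

lemma letter_int: "i < N \<Longrightarrow> letter N (int i) = i"
  by (simp add: letter_def)

lemma letter_less: "N > 0 \<Longrightarrow> letter N a < N"
  by (simp add: letter_def nat_less_iff)

lemma int_letter: "N > 0 \<Longrightarrow> int (letter N a) = a mod int N"
  by (simp add: letter_def)

lemma dvd_letter: "N > 0 \<Longrightarrow> int N dvd int (letter N a) - a"
  by (simp add: int_letter mod_eq_dvd_iff[symmetric])

lemma letter_Suc: "N > 0 \<Longrightarrow> (letter N a + 1) mod N = letter N (a + 1)"
  by (metis Suc_eq_plus1 int_letter letter_def mod_add_left_eq nat_int of_nat_Suc zmod_int add.commute)

lemma mod_eq_dvd: "i < N \<Longrightarrow> j mod int N = int i \<longleftrightarrow> int N dvd j - int i"
  by (metis mod_eq_dvd_iff mod_pos_pos_trivial of_nat_0_le_iff of_nat_less_iff)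

lemma s_gen_eq:
  assumes "i < N" shows "s_gen N i = aff_swap N (int i)"
proof
  fix j
  have "int N dvd j - int ((i + 1) mod N) \<longleftrightarrow> int N dvd j - int i - 1"
    using dvd_diff_swap[of N "int ((i + 1) mod N)" "int i + 1" j]
    by (simp add: zmod_int mod_eq_dvd_iff[symmetric] algebra_simps)
  then show "s_gen N i j = aff_swap N (int i) j"
    unfolding s_gen_def aff_swap_def using assms mod_eq_dvd[of i N j] mod_eq_dvd[of "(i+1) mod N" N j]
    by auto
qed

lemma s_gen_letter: "N > 0 \<Longrightarrow> s_gen N (letter N a) = aff_swap N a"
  by (simp add: s_gen_eq letter_less aff_swap_cong[OF dvd_letter])

lemma lower_letter: "N > 0 \<Longrightarrow> lower N (int (letter N a)) = lower N a"
  by (rule lower_cong[OF dvd_letter])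

section \<open>Words, their two actions, and congruences\<close>

lemma word_perm_append: "word_perm N (u @ v) = word_perm N u \<circ> word_perm N v"
  by (induction u) (simp_all add: word_perm_def comp_assoc)

lemma word_perm_Nil: "word_perm N [] = id"
  by (simp add: word_perm_def)

lemma word_perm_single: "word_perm N [i] = s_gen N i"
  by (simp add: word_perm_def)

lemma word_ndpf_append: "word_ndpf N (u @ v) = word_ndpf N u \<circ> word_ndpf N v"
  by (induction u) (simp_all add: word_ndpf_def comp_assoc)

lemma word_ndpf_Nil: "word_ndpf N [] = id"
  by (simp add: word_ndpf_def)

lemma word_ndpf_single: "word_ndpf N [i] = lower N (int i)"
  by (simp add: word_ndpf_def)

lemma is_word_append: "is_word N (u @ v) \<longleftrightarrow> is_word N u \<and> is_word N v"
  by (auto simp: is_word_def)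

lemma is_word_single: "is_word N [i] \<longleftrightarrow> i < N"
  by (auto simp: is_word_def)

lemma is_word_Nil: "is_word N []"
  by (auto simp: is_word_def)

lemma cong_append:
  assumes "cong_closure R u v" shows "cong_closure R (x @ u @ y) (x @ v @ y)"
  using assms
proof induction
  case (base l r u v)
  then show ?case using cong_closure.base[of R l r "x @ u" "v @ y"] by simp
qed (auto intro: cong_closure.intros)

lemma cong_left: "cong_closure R u v \<Longrightarrow> cong_closure R (x @ u) (x @ v)"
  using cong_append[of R u v x "[]"] by simp

lemma cong_right: "cong_closure R u v \<Longrightarrow> cong_closure R (u @ y) (v @ y)"
  using cong_append[of R u v "[]" y] by simp

lemma cong_rel: "R u v \<Longrightarrow> cong_closure R u v"
  using cong_closure.base[of R u v "[]" "[]"] by simp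

declare cong_closure.trans [trans]

context
  fixes N :: nat
  assumes N3: "N \<ge> 3"
begin

abbreviation "L \<equiv> letter N"

lemma N_pos: "N > 0"
  using N3 by simp

text \<open>The assumption N >= 3 makes a, a + 1, a + 2 distinct residues. The bound 2 is the
  largest shift occurring in the local computations, since a braid relation involves three
  consecutive residues.\<close>

lemma not_dvd_shift:
  assumes "int N dvd x" "c \<noteq> 0" "\<bar>c\<bar> \<le> 2" shows "\<not> int N dvd x + c"
  using dvd_close[OF assms(1), of "x + c"] assms(2,3) N3 by auto

lemma letter_exhaust:
  assumes "i < N" obtains a where "i = L a"
  using letter_int[OF assms] by metis

lemma q_idem: "quot_cong N [L a, L a] [L a]"
  by (rule cong_rel, unfold quot_rel_def hecke_rel_def, rule disjI1, rule disjI1, rule exI[of _ "L a"])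
    (simp add: letter_less[OF N_pos])

lemma q_braid: "quot_cong N [L a, L (a + 1), L a] [L (a + 1), L a, L (a + 1)]"
  by (rule cong_rel, unfold quot_rel_def hecke_rel_def, rule disjI1, rule disjI2, rule disjI2, rule exI[of _ "L a"])
    (simp add: letter_less[OF N_pos] letter_Suc[OF N_pos, simplified])

lemma q_quot: "quot_cong N [L a, L (a + 1), L a] [L a, L (a + 1)]"
  by (rule cong_rel, unfold quot_rel_def hecke_rel_def, rule disjI2, rule exI[of _ "L a"])
    (simp add: letter_less[OF N_pos] letter_Suc[OF N_pos, simplified])

lemma adjacent_letter: "adjacent_mod N (L a) (L b) \<longleftrightarrow> int N dvd b - a - 1 \<or> int N dvd a - b - 1"
  unfolding adjacent_mod_def letter_Suc[OF N_pos] letter_eq_iff[OF N_pos]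
  by (simp add: algebra_simps)

lemma q_comm:
  assumes "\<not> int N dvd b - a - 1" "\<not> int N dvd a - b - 1"
  shows "quot_cong N [L a, L b] [L b, L a]"
  by (rule cong_rel, unfold quot_rel_def hecke_rel_def, rule disjI1, rule disjI2, rule disjI1,
      rule exI[of _ "L a"])
    (simp add: letter_less[OF N_pos] adjacent_letter assms)

section \<open>Relations satisfied by \<open>aff_swap\<close> and \<open>lower\<close>\<close>

lemma aff_swap_aff_swap: "aff_swap N a (aff_swap N a j) = j"
  using not_dvd_shift[of "j - a" "-1"] not_dvd_shift[of "j - a" 1]
  by (auto simp: aff_swap_def algebra_simps)

lemma aff_swap_disjoint:
  assumes "\<not> int N dvd b - a - 1" "\<not> int N dvd a - b - 1" "\<not> int N dvd a - b"
    and "aff_swap N a j \<noteq> j"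
  shows "aff_swap N b j = j"
proof -
  consider "int N dvd j - a" | "int N dvd j - a - 1"
    using assms(4) by (auto simp: aff_swap_def split: if_splits)
  then show ?thesis
  proof cases
    case 1
    then show ?thesis
      using dvd_diff[OF _ 1, of "j - b"] dvd_diff[OF _ 1, of "j - b - 1"] assms(1-3)
      by (auto simp: aff_swap_def algebra_simps)
  next
    case 2
    then show ?thesis
      using dvd_diff[OF 2, of "j - b"] dvd_diff[OF _ 2, of "j - b - 1"] assms(1-3)
      by (auto simp: aff_swap_def algebra_simps)
  qed
qed

lemma aff_swap_comm:
  assumes "\<not> int N dvd b - a - 1" "\<not> int N dvd a - b - 1"
  shows "aff_swap N a \<circ> aff_swap N b = aff_swap N b \<circ> aff_swap N a"
proof (cases "int N dvd a - b")
  case True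
  then show ?thesis using aff_swap_cong by simp
next
  case False
  then have False': "\<not> int N dvd b - a" by (simp add: dvd_diff_commute)
  show ?thesis
  proof
    fix j
    show "(aff_swap N a \<circ> aff_swap N b) j = (aff_swap N b \<circ> aff_swap N a) j"
      using aff_swap_disjoint[OF assms False] aff_swap_disjoint[OF assms(2,1) False']
        aff_swap_aff_swap[of a j] aff_swap_aff_swap[of b j]
      by (metis comp_apply)
  qed
qed

lemma aff_swap_braid:
  "aff_swap N a \<circ> aff_swap N (a + 1) \<circ> aff_swap N a
    = aff_swap N (a + 1) \<circ> aff_swap N a \<circ> aff_swap N (a + 1)"
proof
  fix j
  note * = not_dvd_shift[of "j - a" 1] not_dvd_shift[of "j - a" 2] not_dvd_shift[of "j - a" "-1"]
    not_dvd_shift[of "j - a" "-2"] not_dvd_shift[of "j - a - 1" 1] not_dvd_shift[of "j - a - 1" "-1"]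
    not_dvd_shift[of "j - a - 2" 1] not_dvd_shift[of "j - a - 2" 2]
    not_dvd_shift[of "j - a - 1" 2] not_dvd_shift[of "j - a - 1" "-2"]
    not_dvd_shift[of "j - a - 2" "-1"] not_dvd_shift[of "j - a - 2" "-2"]
  consider "int N dvd j - a" | "int N dvd j - a - 1" | "int N dvd j - a - 2"
    | "\<not> int N dvd j - a" "\<not> int N dvd j - a - 1" "\<not> int N dvd j - a - 2" by blast
  then show "(aff_swap N a \<circ> aff_swap N (a + 1) \<circ> aff_swap N a) j
    = (aff_swap N (a + 1) \<circ> aff_swap N a \<circ> aff_swap N (a + 1)) j"
    by cases (use * in \<open>auto simp: aff_swap_def algebra_simps\<close>)
qed

lemma lower_lower: "lower N a \<circ> lower N a = lower N a"
proof
  fix j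
  show "(lower N a \<circ> lower N a) j = lower N a j"
    using not_dvd_shift[of "j - a - 1" "-1"] by (auto simp: lower_def algebra_simps)
qed

lemma lower_comm:
  assumes "\<not> int N dvd b - a - 1" "\<not> int N dvd a - b - 1"
  shows "lower N a \<circ> lower N b = lower N b \<circ> lower N a"
proof
  fix j
  show "(lower N a \<circ> lower N b) j = (lower N b \<circ> lower N a) j"
    using dvd_diff[of "int N" "j - 1 - b - 1" "j - a - 1"] dvd_diff[of "int N" "j - 1 - a - 1" "j - b - 1"] assms
    by (auto simp: lower_def algebra_simps)
qed

text \<open>\<open>lower N a \<circ> lower N (a + 1)\<close> collapses a, a + 1, a + 2 to a. Hence
  it is unchanged by a preceding \<open>lower N a\<close>, which stays inside this block, and by a
  following \<open>lower N (a + 1)\<close>, since no value is congruent to a + 2.\<close>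

lemma lower_braid:
  "lower N a \<circ> lower N (a + 1) \<circ> lower N a = lower N a \<circ> lower N (a + 1)"
  "lower N (a + 1) \<circ> lower N a \<circ> lower N (a + 1) = lower N a \<circ> lower N (a + 1)"
proof -
  have "(lower N a \<circ> lower N (a + 1) \<circ> lower N a) j = (lower N a \<circ> lower N (a + 1)) j"
    "(lower N (a + 1) \<circ> lower N a \<circ> lower N (a + 1)) j = (lower N a \<circ> lower N (a + 1)) j" for j
    using not_dvd_shift[of "j - a - 1" "-1"] not_dvd_shift[of "j - a - 2" 1]
      not_dvd_shift[of "j - a - 1" "-2"] not_dvd_shift[of "j - a - 2" "-1"]
      not_dvd_shift[of "j - a - 2" "-2"]
    by (auto simp: lower_def algebra_simps)
  then show "lower N a \<circ> lower N (a + 1) \<circ> lower N a = lower N a \<circ> lower N (a + 1)"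
    "lower N (a + 1) \<circ> lower N a \<circ> lower N (a + 1) = lower N a \<circ> lower N (a + 1)"
    by blast+
qed

lemma word_perm_snoc: "word_perm N (u @ [L a]) = word_perm N u \<circ> aff_swap N a"
  by (simp add: word_perm_append word_perm_single s_gen_letter[OF N_pos])

lemma word_ndpf_snoc: "word_ndpf N (u @ [L a]) = word_ndpf N u \<circ> lower N a"
  by (simp add: word_ndpf_append word_ndpf_single lower_letter[OF N_pos])

lemma is_word_snoc: "is_word N (u @ [L a]) \<longleftrightarrow> is_word N u"
  by (simp add: is_word_append is_word_single letter_less[OF N_pos])

lemma word_ndpf_letters:
  "word_ndpf N [L a, L b] = lower N a \<circ> lower N b"
  "word_ndpf N [L a, L b, L c] = lower N a \<circ> lower N b \<circ> lower N c"
  by (simp_all add: word_ndpf_def lower_letter[OF N_pos] comp_assoc)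

lemma word_induct [consumes 1, case_names Nil snoc]:
  assumes "is_word N u" "P []"
    and "\<And>u a. is_word N u \<Longrightarrow> P u \<Longrightarrow> P (u @ [L a])"
  shows "P u"
  using assms(1)
proof (induction u rule: rev_induct)
  case (snoc i u)
  then show ?case using letter_exhaust[of i] assms(3) by (metis is_word_append is_word_single)
qed (rule assms(2))

section \<open>The action by functions is well defined on the quotient\<close>

lemma quot_rel_word_ndpf:
  assumes "quot_rel N l r" shows "word_ndpf N l = word_ndpf N r"
proof -
  consider (idem) i where "i < N" "l = [i, i]" "r = [i]"
    | (comm) i j where "i < N" "j < N" "\<not> adjacent_mod N i j" "l = [i, j]" "r = [j, i]"
    | (braid) i where "i < N" "l = [i, (i + 1) mod N, i]" "r = [(i + 1) mod N, i, (i + 1) mod N]"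
    | (quot) i where "i < N" "l = [i, (i + 1) mod N, i]" "r = [i, (i + 1) mod N]"
    using assms unfolding quot_rel_def hecke_rel_def by blast
  then show ?thesis
  proof cases
    case idem
    then show ?thesis by (simp add: word_ndpf_def lower_lower)
  next
    case comm
    then show ?thesis
      using letter_exhaust[of i] letter_exhaust[of j] lower_comm
      by (metis adjacent_letter word_ndpf_letters(1))
  next
    case braid
    then show ?thesis
      using letter_exhaust[of i] lower_braid
      by (metis letter_Suc[OF N_pos] word_ndpf_letters(2))
  next
    case quot
    then show ?thesis
      using letter_exhaust[of i] lower_braid(1)
      by (metis letter_Suc[OF N_pos] word_ndpf_letters)
  qed
qed

lemma quot_cong_word_ndpf: "quot_cong N u v \<Longrightarrow> word_ndpf N u = word_ndpf N v"
  by (induction rule: cong_closure.induct) (auto simp: word_ndpf_append quot_rel_word_ndpf)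

lemma skew_word_ndpf: "skew N (word_ndpf N u)"
proof (induction u)
  case Nil
  show ?case by (simp add: word_ndpf_Nil skew_def)
next
  case (Cons i u)
  have "word_ndpf N (i # u) = lower N (int i) \<circ> word_ndpf N u" by (simp add: word_ndpf_def)
  then show ?case using skew_comp[OF skew_lower Cons.IH] by (simp only:)
qed

lemma mono_lower: "mono (lower N a)"
proof (rule monoI)
  fix i j :: int assume "i \<le> j"
  then show "lower N a i \<le> lower N a j" by (cases "i = j") (auto simp: lower_def)
qed

lemma mono_word_ndpf: "mono (word_ndpf N u)"
proof (induction u)
  case Nil
  show ?case by (simp add: word_ndpf_Nil mono_def)
next
  case (Cons i u)
  then show ?case using mono_lower[of "int i"] by (simp add: word_ndpf_def mono_def)
qed

lemma word_ndpf_le: "word_ndpf N u i \<le> i"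
proof (induction u)
  case Nil
  show ?case by (simp add: word_ndpf_Nil)
next
  case (Cons k u)
  have "lower N (int k) x \<le> x" for x by (simp add: lower_def)
  then show ?case using Cons by (auto simp: word_ndpf_def intro: order_trans)
qed

lemma lower_simps:
  "int N dvd a - b - 1 \<Longrightarrow> lower N b a = a - 1"
  "\<not> int N dvd a - b - 1 \<Longrightarrow> lower N b a = a"
  "int N dvd a - b \<Longrightarrow> lower N b (a + 1) = a"
  "\<not> int N dvd a - b \<Longrightarrow> lower N b (a + 1) = a + 1"
  by (simp_all add: lower_def algebra_simps)

text \<open>The letter a is moved leftwards past the last letter b. If b is a, it is idempotent; if
  b is far from a, they commute. If b is a - 1, the equation spans the two steps from a - 1 to a +
  1, so by monotonicity v absorbs both letters. The case b = a + 1 needs the additional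
  relation.\<close>

lemma quot_cong_absorb:
  assumes "is_word N v" "word_ndpf N v a = word_ndpf N v (a + 1)"
  shows "quot_cong N (v @ [L a]) v"
  using assms
proof (induction v arbitrary: a rule: word_induct)
  case Nil
  then show ?case by (simp add: word_ndpf_Nil)
next
  case (snoc v b)
  let ?g = "word_ndpf N v"
  have eq: "?g (lower N b a) = ?g (lower N b (a + 1))"
    using snoc.prems by (simp add: word_ndpf_snoc)
  consider "int N dvd a - b" | "int N dvd a - b - 1" | "int N dvd b - a - 1"
    | "\<not> int N dvd a - b" "\<not> int N dvd a - b - 1" "\<not> int N dvd b - a - 1" by blast
  then show ?case
  proof cases
    case 1
    then have "L b = L a" by (simp add: letter_eq_iff[OF N_pos] dvd_diff_commute)
    then show ?thesis using cong_left[OF q_idem[of a], of v] by simp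
  next
    case 2
    then have b: "L b = L (a - 1)"
      by (simp add: letter_eq_iff[OF N_pos] dvd_diff_commute algebra_simps)
    have "\<not> int N dvd a - b" using not_dvd_shift[OF 2, of 1] by simp
    then have "?g (a - 1) = ?g (a + 1)" using eq 2 by (simp add: lower_simps)
    moreover have "?g (a - 1) \<le> ?g a" "?g a \<le> ?g (a + 1)"
      using mono_word_ndpf[of v] by (auto simp: mono_def)
    ultimately have "?g (a - 1) = ?g a" "?g a = ?g (a + 1)" by simp_all
    then have *: "quot_cong N (v @ [L b]) v" "quot_cong N (v @ [L a]) v"
      using snoc.IH[of "a - 1"] snoc.IH[of a] b by simp_all
    have "quot_cong N ((v @ [L b]) @ [L a]) (v @ [L a])"
      by (rule cong_right[OF *(1)])
    also note *(2)
    also have "quot_cong N v (v @ [L b])" by (rule cong_closure.sym[OF *(1)])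
    finally show ?thesis .
  next
    case 3
    then have b: "L b = L (a + 1)" by (simp add: letter_eq_iff[OF N_pos] algebra_simps)
    have "\<not> int N dvd a - b - 1" "\<not> int N dvd a - b"
      using not_dvd_shift[OF 3, of 2] not_dvd_shift[OF 3, of 1]
        dvd_diff_commute[of "int N" a b] dvd_diff_commute[of "int N" a "b + 1"]
      by (simp_all add: algebra_simps)
    then have "?g a = ?g (a + 1)" using eq by (simp add: lower_simps)
    \<comment> \<open>Absorption is used backwards: v may create a letter a in front of a + 1, so
      that the additional relation deletes the final a.\<close>
    then have *: "quot_cong N v (v @ [L a])"
      using snoc.IH cong_closure.sym by blast
    have "quot_cong N ((v @ [L b]) @ [L a]) (v @ [L a, L (a + 1), L a])"
      using cong_right[OF *, of "[L (a + 1), L a]"] by (simp add: b)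
    also have "quot_cong N \<dots> (v @ [L a, L (a + 1)])" by (rule cong_left[OF q_quot])
    also have "quot_cong N \<dots> (v @ [L b])"
      using cong_right[OF cong_closure.sym[OF *], of "[L (a + 1)]"] by (simp add: b)
    finally show ?thesis .
  next
    case 4
    then have "?g a = ?g (a + 1)" using eq by (simp add: lower_simps)
    then have *: "quot_cong N (v @ [L a]) v" by (rule snoc.IH)
    have "quot_cong N ((v @ [L b]) @ [L a]) (v @ [L a, L b])"
      using cong_left[OF q_comm[of a b], of v] 4 by simp
    also have "quot_cong N \<dots> (v @ [L b])" using cong_right[OF *, of "[L b]"] by simp
    finally show ?thesis .
  qed
qed

section \<open>Permutations of words and length-increasing words\<close>

lemma aff_swap_simps:
  "aff_swap N a a = a + 1" "aff_swap N a (a + 1) = a"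
  "aff_swap N a (a - 1) = a - 1" "aff_swap N a (a + 2) = a + 2"
  "aff_swap N (a - 1) a = a - 1" "aff_swap N (a - 1) (a + 1) = a + 1"
  "aff_swap N (a + 1) a = a" "aff_swap N (a + 1) (a + 2) = a + 1"
  using not_dvd_shift[of 0 1] not_dvd_shift[of 0 2] not_dvd_shift[of 0 "-1"] not_dvd_shift[of 0 "-2"]
  by (simp_all add: aff_swap_def)

lemma skew_word_perm: "is_word N u \<Longrightarrow> skew N (word_perm N u)"
proof (induction u rule: word_induct)
  case Nil
  show ?case by (simp add: word_perm_Nil skew_def)
next
  case (snoc u a)
  then show ?case unfolding word_perm_snoc by (intro skew_comp skew_aff_swap)
qed

lemma bij_aff_swap: "bij (aff_swap N a)"
  using aff_swap_aff_swap by (intro involuntory_imp_bij) simp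

lemma bij_word_perm: "is_word N u \<Longrightarrow> bij (word_perm N u)"
proof (induction u rule: word_induct)
  case Nil
  show ?case unfolding word_perm_Nil by (rule bij_id)
next
  case (snoc u a)
  then show ?case unfolding word_perm_snoc by (intro bij_comp bij_aff_swap)
qed

lemma asc_word_is_word: "asc_word N u \<Longrightarrow> is_word N u"
  by (induction rule: asc_word.induct) (simp_all add: is_word_Nil is_word_append is_word_single)

lemma asc_word_snoc:
  assumes "asc_word N u" "word_perm N u a < word_perm N u (a + 1)"
  shows "asc_word N (u @ [L a])"
proof (rule asc_word.snoc[OF assms(1) letter_less[OF N_pos]])
  have "skew N (word_perm N u)" using assms(1) by (simp add: asc_word_is_word skew_word_perm)
  from skew_dvd[OF this, of "int (L a)" a] skew_dvd[OF this, of "int (L a) + 1" "a + 1"]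
  show "word_perm N u (int (L a)) < word_perm N u (int (L a) + 1)"
    using assms(2) dvd_letter[OF N_pos, of a] by simp
qed

lemma asc_word_cases [consumes 1, case_names Nil snoc]:
  assumes "asc_word N r"
  obtains "r = []"
  | u a where "r = u @ [L a]" "asc_word N u" "word_perm N u a < word_perm N u (a + 1)"
  using assms
proof cases
  case (snoc u i)
  then show ?thesis using that(2)[of u "int i"] by (simp add: letter_int)
qed (use that in blast)

lemma asc_word_induct [consumes 1, case_names Nil snoc]:
  assumes "asc_word N r" "P []"
    and "\<And>u a. asc_word N u \<Longrightarrow> P u \<Longrightarrow> word_perm N u a < word_perm N u (a + 1) \<Longrightarrow> P (u @ [L a])"
  shows "P r"
  using assms(1)
proof (induction r rule: asc_word.induct)
  case (snoc u i)
  then show ?case using assms(3)[of u "int i"] by (simp add: letter_int)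
qed (rule assms(2))

text \<open>Swapping the values at a and a + 1 (and their translates) preserves the value set of
  every suffix not starting in the class of a + 1. A suffix starting at i in that class trades w(i)
  for the smaller w(i - 1), so its minimum becomes the one for i - 1, which is
  \<open>lower N a i\<close>.\<close>

lemma suffix_min_asc_word: "asc_word N r \<Longrightarrow> suffix_min (word_perm N r) (word_ndpf N r)"
proof (induction r rule: asc_word_induct)
  case Nil
  show ?case by (auto simp: suffix_min_def word_perm_Nil word_ndpf_Nil)
next
  case (snoc u a)
  let ?w = "word_perm N u" and ?f = "word_ndpf N u"
  have sw: "skew N ?w" using snoc.hyps by (simp add: asc_word_is_word skew_word_perm)
  have up: "?w j < ?w (j + 1)" if "int N dvd j - a" for j
    using that skew_dvd[OF sw, of j a] skew_dvd[OF sw, of "j + 1" "a + 1"] snoc.hyps by simp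
  show ?case unfolding suffix_min_def word_perm_snoc word_ndpf_snoc comp_apply
  proof (intro conjI allI impI)
    fix i k :: int assume "i \<le> k"
    have *: "j \<le> k \<Longrightarrow> ?f j \<le> ?w k" for j k
      using snoc.IH unfolding suffix_min_def by blast
    consider "int N dvd i - a - 1" | "int N dvd k - a" "\<not> int N dvd i - a - 1"
      | "int N dvd k - a - 1" "\<not> int N dvd k - a" "\<not> int N dvd i - a - 1"
      | "\<not> int N dvd k - a" "\<not> int N dvd k - a - 1" "\<not> int N dvd i - a - 1" by blast
    then show "?f (lower N a i) \<le> ?w (aff_swap N a k)"
    proof cases
      case 1
      then have "lower N a i = i - 1" by (simp add: lower_def)
      moreover have "i - 1 \<le> aff_swap N a k" using \<open>i \<le> k\<close> by (simp add: aff_swap_def)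
      ultimately show ?thesis using * by simp
    next
      case 2
      then show ?thesis using *[of i "k + 1"] \<open>i \<le> k\<close> by (simp add: lower_def aff_swap_def)
    next
      case 3
      then have "i \<noteq> k" by auto
      then show ?thesis using 3 *[of i "k - 1"] \<open>i \<le> k\<close> by (simp add: lower_def aff_swap_def)
    next
      case 4
      then show ?thesis using *[of i k] \<open>i \<le> k\<close> by (simp add: lower_def aff_swap_def)
    qed
  next
    fix i
    obtain k where k: "k \<ge> lower N a i" "?w k = ?f (lower N a i)"
      using snoc.IH unfolding suffix_min_def by blast
    have *: "?w j \<ge> ?f (lower N a i)" if "j \<ge> lower N a i" for j
      using snoc.IH that unfolding suffix_min_def by blast
    \<comment> \<open>The old minimum sits at k, hence the new one at \<open>aff_swap N a k\<close>.
      This could leave the suffix only for k = i congruent to a + 1, but then w(k - 1) < w(k)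
      contradicts minimality, as the old suffix starts at i - 1.\<close>
    have "aff_swap N a k \<ge> i"
    proof (rule ccontr)
      assume neg: "\<not> i \<le> aff_swap N a k"
      have ik: "i \<le> k + 1" "i = k + 1 \<Longrightarrow> int N dvd k - a"
        using k(1) by (auto simp: lower_def split: if_splits)
      have "aff_swap N a k \<ge> k - 1" by (simp add: aff_swap_def)
      with neg ik have "i = k \<or> i = k + 1" by linarith
      then show False
      proof
        assume "i = k + 1"
        with ik neg show False by (simp add: aff_swap_def)
      next
        assume ki: "i = k"
        then have d: "int N dvd k - a - 1" using neg by (auto simp: aff_swap_def split: if_splits)
        then have "?w (k - 1) < ?w k" using up[of "k - 1"] by (simp add: algebra_simps)
        moreover have "?w (k - 1) \<ge> ?f (lower N a i)"
          using * d ki by (simp add: lower_def)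
        ultimately show False using k(2) by simp
      qed
    qed
    then show "\<exists>k\<ge>i. ?w (aff_swap N a k) = ?f (lower N a i)"
      using k(2) aff_swap_aff_swap by metis
  qed
qed

text \<open>The exchange condition, up to the relations: this replaces Matsumoto's theorem.\<close>
lemma asc_word_descent:
  assumes "asc_word N r" "word_perm N r (a + 1) < word_perm N r a"
  shows "\<exists>x. asc_word N x \<and> length r = Suc (length x) \<and>
    word_perm N x = word_perm N r \<circ> aff_swap N a \<and> quot_cong N r (x @ [L a])"
  using assms
proof (induction "length r" arbitrary: r a rule: less_induct)
  case less
  let ?w = "word_perm N r"
  from less.prems(1) show ?case
  proof (cases rule: asc_word_cases)
    case Nil
    then show ?thesis using less.prems(2) by (simp add: word_perm_Nil)
  next
    case (snoc y b)
    have sw: "skew N ?w" using less.prems by (simp add: asc_word_is_word skew_word_perm)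
    have wy: "word_perm N y = ?w \<circ> aff_swap N b"
      using snoc(1) by (simp add: word_perm_snoc fun_eq_iff aff_swap_aff_swap)
    have wb: "?w (b + 1) < ?w b" using snoc(3) by (simp add: wy aff_swap_simps)
    have ly: "length y < length r" using snoc(1) by simp
    note sd = skew_dvd[OF sw]
    consider "int N dvd a - b" | "int N dvd a - b - 1" | "int N dvd b - a - 1"
      | "\<not> int N dvd a - b" "\<not> int N dvd a - b - 1" "\<not> int N dvd b - a - 1" by blast
    then show ?thesis
    proof cases
      case 1
      then have "L b = L a" "aff_swap N b = aff_swap N a"
        using aff_swap_cong by (simp_all add: letter_eq_iff[OF N_pos] dvd_diff_commute)
      then show ?thesis using snoc(1,2) wy by (intro exI[of _ y]) (auto intro: cong_closure.refl)
    next
      \<comment> \<open>Here w(a - 1) > w(a) > w(a + 1). Three descents are peeled off, so r becomes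
        t (a - 1) a (a - 1), and the braid relation turns this into t a (a - 1) a. The witness is t
        a (a - 1).\<close>
      case 2
      then have d: "int N dvd b - (a - 1)" by (simp add: dvd_diff_commute algebra_simps)
      then have b: "L b = L (a - 1)" "aff_swap N b = aff_swap N (a - 1)"
        using aff_swap_cong by (simp_all add: letter_eq_iff[OF N_pos])
      have w1: "?w a < ?w (a - 1)" using wb sd[OF d] sd[of "b + 1" a] d by (simp add: algebra_simps)
      have wy': "word_perm N y = ?w \<circ> aff_swap N (a - 1)" using wy b(2) by simp
      have "word_perm N y (a + 1) < word_perm N y a"
        using w1 less.prems(2) by (simp add: wy' aff_swap_simps)
      then obtain z where z: "asc_word N z" "length y = Suc (length z)"
        "word_perm N z = word_perm N y \<circ> aff_swap N a" "quot_cong N y (z @ [L a])"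
        using less.hyps[OF ly snoc(2)] by blast
      have wz: "word_perm N z a < word_perm N z (a - 1)"
        using less.prems(2) by (simp add: z(3) wy' aff_swap_simps)
      moreover have "length z < length r" using ly z(2) by simp
      ultimately obtain t where t: "asc_word N t" "length z = Suc (length t)"
        "word_perm N t = word_perm N z \<circ> aff_swap N (a - 1)" "quot_cong N z (t @ [L (a - 1)])"
        using less.hyps[OF _ z(1), of "a - 1"] by auto
      have wt: "word_perm N t = ?w \<circ> aff_swap N (a - 1) \<circ> aff_swap N a \<circ> aff_swap N (a - 1)"
        by (simp add: t(3) z(3) wy')
      have wta: "word_perm N (t @ [L a]) = word_perm N t \<circ> aff_swap N a" by (rule word_perm_snoc)
      have x1: "asc_word N (t @ [L a])"
        by (rule asc_word_snoc[OF t(1)]) (use w1 in \<open>simp add: wt aff_swap_simps\<close>)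
      have x2: "asc_word N ((t @ [L a]) @ [L (a - 1)])"
        by (rule asc_word_snoc[OF x1])
          (use less.prems(2) w1 in \<open>simp add: wta wt aff_swap_simps\<close>)
      have x3: "word_perm N ((t @ [L a]) @ [L (a - 1)]) = ?w \<circ> aff_swap N a"
      proof -
        have "word_perm N ((t @ [L a]) @ [L (a - 1)])
          = ?w \<circ> (aff_swap N (a - 1) \<circ> aff_swap N a \<circ> aff_swap N (a - 1)) \<circ> aff_swap N a \<circ> aff_swap N (a - 1)"
          by (simp only: word_perm_snoc wt comp_assoc)
        also have "\<dots> = ?w \<circ> (aff_swap N a \<circ> aff_swap N (a - 1) \<circ> aff_swap N a) \<circ> aff_swap N a \<circ> aff_swap N (a - 1)"
          using aff_swap_braid[of "a - 1"] by simp
        also have "\<dots> = ?w \<circ> aff_swap N a" by (simp add: fun_eq_iff aff_swap_aff_swap)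
        finally show ?thesis .
      qed
      have "quot_cong N r (z @ [L a, L (a - 1)])"
        using cong_right[OF z(4), of "[L (a - 1)]"] by (simp add: snoc(1) b(1))
      also have "quot_cong N \<dots> (t @ [L (a - 1), L a, L (a - 1)])"
        using cong_right[OF t(4), of "[L a, L (a - 1)]"] by simp
      also have "quot_cong N \<dots> (t @ [L a, L (a - 1), L a])"
        using cong_left[OF q_braid[of "a - 1"], of t] by simp
      finally show ?thesis using x2 x3 z(2) t(2) snoc(1)
        by (intro exI[of _ "(t @ [L a]) @ [L (a - 1)]"]) simp
    next
      \<comment> \<open>The mirror image, with w(a) > w(a + 1) > w(a + 2) and witness t a (a +
        1).\<close>
      case 3
      then have d: "int N dvd b - (a + 1)" by (simp add: algebra_simps)
      then have b: "L b = L (a + 1)" "aff_swap N b = aff_swap N (a + 1)"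
        using aff_swap_cong by (simp_all add: letter_eq_iff[OF N_pos])
      have w1: "?w (a + 2) < ?w (a + 1)"
        using wb sd[OF d] sd[of "b + 1" "a + 2"] d by (simp add: algebra_simps)
      have a2: "a + 1 + 1 = a + 2" by simp
      have "aff_swap N (a + 1) (a + 1) = a + 2" by (simp add: aff_swap_def)
      note sw_at = this aff_swap_simps(1)[of a] aff_swap_simps(2)[of a] aff_swap_simps(4)[of a]
        aff_swap_simps(7)[of a] aff_swap_simps(8)[of a]
      have wy': "word_perm N y = ?w \<circ> aff_swap N (a + 1)" using wy b(2) by simp
      have "word_perm N y (a + 1) < word_perm N y a"
        using less_trans[OF w1 less.prems(2)] by (simp only: wy' comp_apply sw_at)
      then obtain z where z: "asc_word N z" "length y = Suc (length z)"
        "word_perm N z = word_perm N y \<circ> aff_swap N a" "quot_cong N y (z @ [L a])"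
        using less.hyps[OF ly snoc(2)] by blast
      have wz: "word_perm N z (a + 2) < word_perm N z (a + 1)"
        using less.prems(2) by (simp only: z(3) wy' comp_apply sw_at)
      moreover have "length z < length r" using ly z(2) by simp
      ultimately obtain t where t: "asc_word N t" "length z = Suc (length t)"
        "word_perm N t = word_perm N z \<circ> aff_swap N (a + 1)" "quot_cong N z (t @ [L (a + 1)])"
        using less.hyps[OF _ z(1), of "a + 1"] unfolding a2 by blast
      have wt: "word_perm N t = ?w \<circ> aff_swap N (a + 1) \<circ> aff_swap N a \<circ> aff_swap N (a + 1)"
        by (simp add: t(3) z(3) wy')
      have wta: "word_perm N (t @ [L a]) = word_perm N t \<circ> aff_swap N a" by (rule word_perm_snoc)
      have x1: "asc_word N (t @ [L a])"
        by (rule asc_word_snoc[OF t(1)])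
          (use w1 in \<open>simp only: wt comp_apply sw_at\<close>)
      have x2: "asc_word N ((t @ [L a]) @ [L (a + 1)])"
        by (rule asc_word_snoc[OF x1])
          (use less_trans[OF w1 less.prems(2)] in \<open>simp only: wta wt comp_apply a2 sw_at\<close>)
      have x3: "word_perm N ((t @ [L a]) @ [L (a + 1)]) = ?w \<circ> aff_swap N a"
      proof -
        have "word_perm N ((t @ [L a]) @ [L (a + 1)])
          = ?w \<circ> (aff_swap N (a + 1) \<circ> aff_swap N a \<circ> aff_swap N (a + 1)) \<circ> aff_swap N a \<circ> aff_swap N (a + 1)"
          by (simp only: word_perm_snoc wt comp_assoc)
        also have "\<dots> = ?w \<circ> (aff_swap N a \<circ> aff_swap N (a + 1) \<circ> aff_swap N a) \<circ> aff_swap N a \<circ> aff_swap N (a + 1)"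
          using aff_swap_braid[of a] by simp
        also have "\<dots> = ?w \<circ> aff_swap N a" by (simp add: fun_eq_iff aff_swap_aff_swap)
        finally show ?thesis .
      qed
      have "quot_cong N r (z @ [L a, L (a + 1)])"
        using cong_right[OF z(4), of "[L (a + 1)]"] by (simp add: snoc(1) b(1))
      also have "quot_cong N \<dots> (t @ [L (a + 1), L a, L (a + 1)])"
        using cong_right[OF t(4), of "[L a, L (a + 1)]"] by simp
      also have "quot_cong N \<dots> (t @ [L a, L (a + 1), L a])"
        using cong_left[OF cong_closure.sym[OF q_braid[of a]], of t] by simp
      finally show ?thesis using x2 x3 z(2) t(2) snoc(1)
        by (intro exI[of _ "(t @ [L a]) @ [L (a + 1)]"]) simp
    next
      case 4
      have comm: "aff_swap N a \<circ> aff_swap N b = aff_swap N b \<circ> aff_swap N a"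
        using aff_swap_comm 4 by blast
      have dis: "\<not> int N dvd b - a" using 4(1) by (simp add: dvd_diff_commute)
      have ba: "aff_swap N b a = a" "aff_swap N b (a + 1) = a + 1"
        using aff_swap_disjoint[OF 4(3) 4(2) 4(1), of a] aff_swap_disjoint[OF 4(3) 4(2) 4(1), of "a + 1"]
        by (simp_all add: aff_swap_simps)
      have ab: "aff_swap N a b = b" "aff_swap N a (b + 1) = b + 1"
        using aff_swap_disjoint[OF 4(2) 4(3) dis, of b] aff_swap_disjoint[OF 4(2) 4(3) dis, of "b + 1"]
        by (simp_all add: aff_swap_simps)
      have "word_perm N y (a + 1) < word_perm N y a"
        using less.prems(2) by (simp add: wy ba)
      then obtain z where z: "asc_word N z" "length y = Suc (length z)"
        "word_perm N z = word_perm N y \<circ> aff_swap N a" "quot_cong N y (z @ [L a])"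
        using less.hyps[OF ly snoc(2)] by blast
      have x1: "asc_word N (z @ [L b])"
        by (rule asc_word_snoc[OF z(1)]) (use wb in \<open>simp add: z(3) wy ab aff_swap_simps\<close>)
      have "word_perm N (z @ [L b]) = ?w \<circ> aff_swap N b \<circ> (aff_swap N a \<circ> aff_swap N b)"
        by (simp add: word_perm_snoc z(3) wy comp_assoc)
      also have "\<dots> = ?w \<circ> aff_swap N a"
        unfolding comm by (simp add: fun_eq_iff aff_swap_aff_swap)
      finally have x2: "word_perm N (z @ [L b]) = ?w \<circ> aff_swap N a" .
      have "quot_cong N r (z @ [L a, L b])"
        using cong_right[OF z(4), of "[L b]"] by (simp add: snoc(1))
      also have "quot_cong N \<dots> (z @ [L b, L a])"
        by (rule cong_left[OF q_comm[OF 4(3) 4(2)]])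
      finally show ?thesis using x1 x2 z(2) snoc(1) by (intro exI[of _ "z @ [L b]"]) simp
    qed
  qed
qed

text \<open>The last letter of r is a descent of the common permutation, so q is congruent to a word
  ending in it; cancel and induct. Equality of lengths is what later identifies length-increasing
  words with reduced ones.\<close>

lemma asc_word_unique:
  assumes "asc_word N r" "asc_word N q" "word_perm N r = word_perm N q"
  shows "length r = length q" "quot_cong N r q"
proof -
  have "length r = length q \<and> quot_cong N r q"
    using assms
  proof (induction r arbitrary: q rule: asc_word_induct)
    case Nil
    from Nil.prems(1) show ?case
    proof (cases rule: asc_word_cases)
      case Nil
      then show ?thesis by (simp add: cong_closure.refl)
    next
      case (snoc u a)
      have *: "word_perm N u (aff_swap N a j) = j" for j
        using fun_cong[OF Nil.prems(2), of j] snoc(1) by (simp add: word_perm_snoc word_perm_Nil)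
      show ?thesis using snoc(3) *[of a] *[of "a + 1"] by (simp add: aff_swap_simps)
    qed
  next
    case (snoc u a)
    have "word_perm N q (a + 1) < word_perm N q a"
      using snoc.prems(2)[symmetric] snoc.hyps(2) by (simp add: word_perm_snoc aff_swap_simps)
    then obtain x where x: "asc_word N x" "length q = Suc (length x)"
      "word_perm N x = word_perm N q \<circ> aff_swap N a" "quot_cong N q (x @ [L a])"
      using asc_word_descent[OF snoc.prems(1)] by blast
    have "word_perm N u = word_perm N x"
      unfolding x(3) snoc.prems(2)[symmetric] by (simp add: word_perm_snoc fun_eq_iff aff_swap_aff_swap)
    then have IH: "length u = length x" "quot_cong N u x" using snoc.IH[OF x(1)] by auto
    have "quot_cong N (u @ [L a]) (x @ [L a])" by (rule cong_right[OF IH(2)])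
    also have "quot_cong N \<dots> q" by (rule cong_closure.sym[OF x(4)])
    finally show ?case using IH(1) x(2) by simp
  qed
  then show "length r = length q" "quot_cong N r q" by auto
qed

section \<open>Avoiding representatives of the congruence classes\<close>

lemma avoids_321_descent:
  assumes "skew N w" "avoids_321 w" "w (a + 1) < w a"
  shows "avoids_321 (w \<circ> aff_swap N a)"
  unfolding avoids_321_def
proof
  let ?s = "aff_swap N a"
  \<comment> \<open>The only pairs whose order is reversed by the swap are the translates of (a, a +
    1), and there the new permutation ascends. So every inversion of it, and with it every [321]
    pattern, is carried to w in the same order.\<close>
  have *: "?s x < ?s y" if "x < y" "w (?s y) < w (?s x)" for x y
  proof (rule ccontr)
    assume neg: "\<not> ?s x < ?s y"
    then have "y = x + 1 \<and> int N dvd x - a"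
    proof -
      have "?s x \<noteq> ?s y" using that by auto
      then show ?thesis using neg that(1) not_dvd_shift[of "x - a" 1]
        by (auto simp: aff_swap_def split: if_splits)
    qed
    moreover from this have "?s x = x + 1" "?s y = x"
      using not_dvd_shift[of "x - a" 1] by (auto simp: aff_swap_def algebra_simps)
    moreover have "w (x + 1) < w x" if "int N dvd x - a"
      using assms(3) that skew_dvd[OF assms(1), of x a] skew_dvd[OF assms(1), of "x + 1" "a + 1"] by simp
    ultimately show False using that(2) by simp
  qed
  assume "\<exists>x y z. x < y \<and> y < z \<and> (w \<circ> ?s) x > (w \<circ> ?s) y \<and> (w \<circ> ?s) y > (w \<circ> ?s) z"
  then show False using assms(2) * unfolding avoids_321_def comp_apply by meson
qed

text \<open>If appending i creates a [321] pattern, it has the form (a, i, i + 1) with a < i. For the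
  largest such a, either a = i - 1, and the word ends in i (i - 1) i up to the relations, where the
  additional relation drops a letter; or a is a descent whose letter commutes with i, and
  it can be moved out of the way.\<close>
lemma asc_word_extend:
  assumes "asc_word N r" "avoids_321 (word_perm N r)"
  shows "(asc_word N (r @ [L i]) \<and> avoids_321 (word_perm N (r @ [L i]))) \<or>
    (\<exists>q. asc_word N q \<and> avoids_321 (word_perm N q) \<and> length q \<le> length r \<and>
      quot_cong N (r @ [L i]) q)"
  using assms
proof (induction "length r" arbitrary: r i rule: less_induct)
  case less
  let ?w = "word_perm N r" and ?f = "word_ndpf N r"
  let ?s = "aff_swap N i"
  have r: "is_word N r" by (rule asc_word_is_word[OF less.prems(1)])
  have sw: "skew N ?w" by (rule skew_word_perm[OF r])
  note sd = skew_dvd[OF sw]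
  \<comment> \<open>Relaxing the length bound by one merges the two alternatives of the induction
    hypothesis.\<close>
  have ext: "\<exists>q. asc_word N q \<and> avoids_321 (word_perm N q) \<and> length q \<le> Suc (length y) \<and>
      quot_cong N (y @ [L j]) q"
    if "length y < length r" "asc_word N y" "avoids_321 (word_perm N y)" for y j
    using less.hyps[OF that, of j]
  proof
    assume "asc_word N (y @ [L j]) \<and> avoids_321 (word_perm N (y @ [L j]))"
    then show ?thesis by (intro exI[of _ "y @ [L j]"]) (simp add: cong_closure.refl)
  qed (use le_SucI in blast)
  show ?case
  proof (cases "?f i = ?f (i + 1)")
    case True
    then show ?thesis using quot_cong_absorb[OF r] less.prems by blast
  next
    case False
    have sm: "j \<le> k \<Longrightarrow> ?f j \<le> ?w k" "\<exists>k\<ge>j. ?w k = ?f j" for j k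
      using suffix_min_asc_word[OF less.prems(1)] unfolding suffix_min_def by blast+
    have fi: "?f i < ?f (i + 1)"
      using False mono_word_ndpf[of r] by (simp add: mono_def order_less_le)
    obtain k0 where k0: "k0 \<ge> i" "?w k0 = ?f i" using sm(2) by blast
    \<comment> \<open>Since f jumps at i, the minimum of the suffix from i is attained at i itself:
      w(i) lies below all later values.\<close>
    have "k0 = i" using k0 fi sm(1)[of "i + 1" k0] by (cases "k0 = i") auto
    then have "?w i < ?w k" if "i < k" for k
      using k0 fi sm(1)[of "i + 1" k] that by simp
    then have low: "?w x < ?w k" if "int N dvd x - i" "x < k" for x k
      using sd[of x i] sd[of k "k - (x - i)"] that by simp
    have asc: "asc_word N (r @ [L i])"
      by (rule asc_word_snoc[OF less.prems(1)]) (use low[of i "i + 1"] in simp)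
    show ?thesis
    proof (cases "avoids_321 (word_perm N (r @ [L i]))")
      case True
      then show ?thesis using asc by blast
    next
      case False
      then obtain x y z where xyz: "x < y" "y < z" "?w (?s x) > ?w (?s y)" "?w (?s y) > ?w (?s z)"
        unfolding word_perm_snoc avoids_321_def by auto
      have sinj: "?s k = ?s l \<longleftrightarrow> k = l" for k l using aff_swap_aff_swap by metis
      have swapped: "l = k + 1 \<and> int N dvd k - i \<and> ?s k = k + 1 \<and> ?s l = k" if "k < l" "\<not> ?s k < ?s l" for k l
      proof -
        have "l = k + 1 \<and> int N dvd k - i"
          using that sinj[of k l] by (auto simp: aff_swap_def split: if_splits)
        then show ?thesis using not_dvd_shift[of "k - i" 1] by (auto simp: aff_swap_def algebra_simps)
      qed
      \<comment> \<open>A new pattern must use a swapped pair. It cannot be (x, y): the second entry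
        would be the value at a translate of i, which is below everything after it, leaving no third
        entry. So it is (y, z), and translating y to i gives the position d.\<close>
      have 1: "?s x < ?s y"
      proof (rule ccontr)
        assume "\<not> ?s x < ?s y"
        then have s: "y = x + 1" "int N dvd x - i" "?s x = x + 1" "?s y = x"
          using swapped[OF xyz(1)] by auto
        have "?s z \<ge> z - 1" "?s z \<noteq> x + 1" using sinj[of z x] xyz s by (auto simp: aff_swap_def)
        then have "?w x < ?w (?s z)" using low[OF s(2)] xyz s by simp
        then show False using xyz s by simp
      qed
      then have "\<not> ?s y < ?s z"
        using less.prems(2) xyz unfolding avoids_321_def by blast
      then have s: "z = y + 1" "int N dvd y - i" "?s y = y + 1" "?s z = y"
        using swapped[OF xyz(2)] by auto
      define d where "d = ?s x - (y - i)"
      have "?s x \<le> x + 1" "?s x \<noteq> y" using sinj[of z x] xyz s by (auto simp: aff_swap_def)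
      then have d: "d < i" "?w d > ?w (i + 1)"
        using xyz s sd[of d "?s x"] sd[of "y + 1" "i + 1"] by (simp_all add: d_def dvd_diff_commute)
      \<comment> \<open>The largest a < i with w(a) > w(i + 1) is found as the least n with a = i -
        1 - n.\<close>
      define P where "P n \<longleftrightarrow> ?w (i - 1 - int n) > ?w (i + 1)" for n
      have "P (nat (i - 1 - d))" using d by (simp add: P_def)
      then obtain n where n: "P n" "\<And>m. m < n \<Longrightarrow> \<not> P m"
        using exists_least_iff[of P] by blast
      define a where "a = i - 1 - int n"
      have a: "a < i" "?w a > ?w (i + 1)" using n(1) by (simp_all add: a_def P_def)
      have amax: "?w k \<le> ?w (i + 1)" if "a < k" "k < i" for k
        using n(2)[of "nat (i - 1 - k)"] that by (simp add: P_def a_def nat_less_iff)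
      have wi: "?w i < ?w (i + 1)" using low[of i "i + 1"] by simp
      show ?thesis
      proof (cases "a = i - 1")
        \<comment> \<open>Now w(i - 1) > w(i + 1) > w(i), so i - 1 and then i can be peeled off: r i
          becomes y i (i - 1) i, then y (i - 1) i (i - 1), then y (i - 1) i. The last word has the
          length of r, and two extensions of y keep this bound.\<close>
        case True
        have "?w i < ?w (i - 1)" using a wi True by simp
        then obtain x where x: "asc_word N x" "length r = Suc (length x)"
          "word_perm N x = ?w \<circ> aff_swap N (i - 1)" "quot_cong N r (x @ [L (i - 1)])"
          using asc_word_descent[OF less.prems(1), of "i - 1"] by auto
        have ax: "avoids_321 (word_perm N x)"
          unfolding x(3) using avoids_321_descent[OF sw less.prems(2), of "i - 1"] \<open>?w i < ?w (i - 1)\<close> by simp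
        have dx: "word_perm N x (i + 1) < word_perm N x i"
          using a True by (simp add: x(3) aff_swap_simps)
        then obtain y where y: "asc_word N y" "length x = Suc (length y)"
          "word_perm N y = word_perm N x \<circ> aff_swap N i" "quot_cong N x (y @ [L i])"
          using asc_word_descent[OF x(1)] by auto
        have ay: "avoids_321 (word_perm N y)"
          unfolding y(3) using avoids_321_descent[OF skew_word_perm ax dx] asc_word_is_word x(1) by blast
        obtain p where p: "asc_word N p" "avoids_321 (word_perm N p)" "length p \<le> Suc (length y)"
          "quot_cong N (y @ [L (i - 1)]) p"
          using ext[OF _ y(1) ay] x(2) y(2) by force
        obtain q where q: "asc_word N q" "avoids_321 (word_perm N q)" "length q \<le> Suc (length p)"
          "quot_cong N (p @ [L i]) q"
          using ext[OF _ p(1,2)] x(2) y(2) p(3) by force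
        have "quot_cong N (r @ [L i]) (x @ [L (i - 1), L i])"
          using cong_right[OF x(4), of "[L i]"] by simp
        also have "quot_cong N \<dots> (y @ [L i, L (i - 1), L i])"
          using cong_right[OF y(4), of "[L (i - 1), L i]"] by simp
        also have "quot_cong N \<dots> (y @ [L (i - 1), L i, L (i - 1)])"
          using cong_left[OF cong_closure.sym[OF q_braid[of "i - 1"]], of y] by simp
        also have "quot_cong N \<dots> (y @ [L (i - 1), L i])"
          using cong_left[OF q_quot[of "i - 1"], of y] by simp
        also have "quot_cong N \<dots> (p @ [L i])"
          using cong_right[OF p(4), of "[L i]"] by simp
        also note q(4)
        finally show ?thesis using q x(2) y(2) p(3) by (intro disjI2 exI[of _ q]) simp
      next
        case False
        then have ai: "a + 1 < i" using a(1) by simp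
        have da: "?w (a + 1) < ?w a" using amax[of "a + 1"] ai a(2) by simp
        then obtain x where x: "asc_word N x" "length r = Suc (length x)"
          "word_perm N x = ?w \<circ> aff_swap N a" "quot_cong N r (x @ [L a])"
          using asc_word_descent[OF less.prems(1)] by blast
        have ax: "avoids_321 (word_perm N x)"
          unfolding x(3) by (rule avoids_321_descent[OF sw less.prems(2) da])
        \<comment> \<open>If a were congruent to i, i - 1 or i + 1, periodicity would make the value
          there exceed w(a), against the choice of a. Hence the letters a and i are neither equal
          nor adjacent.\<close>
        have n1: "\<not> int N dvd i - a" using sd[of i a] a wi by auto
        have n2: "\<not> int N dvd i - a - 1"
        proof
          assume "int N dvd i - a - 1"
          then have "?w (i - 1) = ?w a + (i - 1 - a)" using sd[of "i - 1" a] by (simp add: algebra_simps)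
          then show False using amax[of "i - 1"] ai a(2) by simp
        qed
        have n3: "\<not> int N dvd a - i - 1"
        proof
          assume "int N dvd a - i - 1"
          then have "int N dvd i + 1 - a"
            using dvd_diff_commute[of "int N" a "i + 1"] by (simp add: algebra_simps)
          then show False using sd[of "i + 1" a] a by simp
        qed
        have n0: "\<not> int N dvd a - i" using n1 by (simp add: dvd_diff_commute)
        have "?s a = a" "?s (a + 1) = a + 1"
          using aff_swap_disjoint[OF n2 n3 n0, of a] aff_swap_disjoint[OF n2 n3 n0, of "a + 1"]
          by (simp_all add: aff_swap_simps)
        moreover have "aff_swap N a i = i" "aff_swap N a (i + 1) = i + 1"
          using aff_swap_disjoint[OF n3 n2 n1, of i] aff_swap_disjoint[OF n3 n2 n1, of "i + 1"]
          by (simp_all add: aff_swap_simps)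
        ultimately have "word_perm N (x @ [L i]) (a + 1) = ?w a" "word_perm N (x @ [L i]) i = ?w (i + 1)"
          "word_perm N (x @ [L i]) (i + 1) = ?w i"
          by (simp_all add: word_perm_snoc x(3) aff_swap_simps)
        \<comment> \<open>The pattern survives at a + 1, i, i + 1. This excludes the first
          alternative of the induction hypothesis and saves the letter needed to append a
          again.\<close>
        then have "\<not> avoids_321 (word_perm N (x @ [L i]))"
          unfolding avoids_321_def using ai a wi by (metis zless_add1_eq)
        then obtain p where p: "asc_word N p" "avoids_321 (word_perm N p)" "length p \<le> length x"
          "quot_cong N (x @ [L i]) p"
          using less.hyps[OF _ x(1) ax, of i] x(2) by auto
        obtain q where q: "asc_word N q" "avoids_321 (word_perm N q)" "length q \<le> Suc (length p)"
          "quot_cong N (p @ [L a]) q"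
          using ext[OF _ p(1,2)] x(2) p(3) by force
        have "quot_cong N (r @ [L i]) (x @ [L a, L i])"
          using cong_right[OF x(4), of "[L i]"] by simp
        also have "quot_cong N \<dots> (x @ [L i, L a])"
          by (rule cong_left[OF q_comm[OF n2 n3]])
        also have "quot_cong N \<dots> (p @ [L a])"
          using cong_right[OF p(4), of "[L a]"] by simp
        also note q(4)
        finally show ?thesis using q x(2) p(3) by (intro disjI2 exI[of _ q]) simp
      qed
    qed
  qed
qed

lemma quot_cong_avoiding:
  assumes "is_word N u"
  shows "\<exists>r. asc_word N r \<and> avoids_321 (word_perm N r) \<and> quot_cong N r u"
  using assms
proof (induction u rule: word_induct)
  case Nil
  show ?case
    by (intro exI[of _ "[]"]) (simp add: asc_word.Nil cong_closure.refl word_perm_Nil avoids_321_def)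
next
  case (snoc u a)
  then obtain r where r: "asc_word N r" "avoids_321 (word_perm N r)" "quot_cong N r u" by blast
  have *: "quot_cong N (r @ [L a]) (u @ [L a])" by (rule cong_right[OF r(3)])
  from asc_word_extend[OF r(1,2), of a] show ?case
    using * cong_closure.sym cong_closure.trans by blast
qed

section \<open>Length-increasing words are exactly the reduced words\<close>

lemma asc_word_or_shorter:
  assumes "is_word N u"
  shows "asc_word N u \<or> (\<exists>q. asc_word N q \<and> word_perm N q = word_perm N u \<and> length q < length u)"
  using assms
proof (induction u rule: word_induct)
  case Nil
  show ?case by (simp add: asc_word.Nil)
next
  case (snoc u a)
  \<comment> \<open>An ascent can be appended; at a descent, \<open>asc_word_descent\<close>
    supplies a word one letter shorter than q instead of one longer.\<close>
  have step: "\<exists>q'. asc_word N q' \<and> word_perm N q' = word_perm N (q @ [L a]) \<and>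
      (q' = q @ [L a] \<or> length q' < length q)" if "asc_word N q" for q
  proof -
    have "word_perm N q a \<noteq> word_perm N q (a + 1)"
      using bij_word_perm[OF asc_word_is_word[OF that]] by (simp add: bij_def inj_eq)
    then consider "word_perm N q a < word_perm N q (a + 1)" | "word_perm N q (a + 1) < word_perm N q a"
      by linarith
    then show ?thesis
    proof cases
      case 1
      then show ?thesis using asc_word_snoc[OF that] by blast
    next
      case 2
      then show ?thesis using asc_word_descent[OF that 2] by (auto simp: word_perm_snoc)
    qed
  qed
  from snoc.IH show ?case
  proof
    assume "asc_word N u"
    then show ?thesis using step[of u] by fastforce
  next
    assume "\<exists>q. asc_word N q \<and> word_perm N q = word_perm N u \<and> length q < length u"
    then obtain q where q: "asc_word N q" "word_perm N q = word_perm N u" "length q < length u" by blast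
    from step[OF q(1)] obtain q' where q': "asc_word N q'" "word_perm N q' = word_perm N (q @ [L a])"
      "q' = q @ [L a] \<or> length q' < length q" by blast
    then have "length q' < length (u @ [L a])" using q(3) by auto
    then show ?thesis using q' q(2) by (auto simp: word_perm_snoc)
  qed
qed

lemma reduced_word_iff_asc_word: "reduced_word N w r \<longleftrightarrow> asc_word N r \<and> word_perm N r = w"
proof
  assume r: "reduced_word N w r"
  then have w: "is_word N r" "word_perm N r = w" by (simp_all add: reduced_word_def)
  have "\<not> length q < length r" if "asc_word N q" "word_perm N q = w" for q
    using r asc_word_is_word[OF that(1)] that(2) by (auto simp: reduced_word_def not_less)
  then show "asc_word N r \<and> word_perm N r = w" using asc_word_or_shorter[OF w(1)] w(2) by auto
next
  assume r: "asc_word N r \<and> word_perm N r = w"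
  have "length r \<le> length u" if u: "is_word N u" "word_perm N u = w" for u
    using asc_word_or_shorter[OF u(1)]
  proof
    assume "asc_word N u"
    then show ?thesis using asc_word_unique(1)[of r u] r u(2) by simp
  next
    assume "\<exists>q. asc_word N q \<and> word_perm N q = word_perm N u \<and> length q < length u"
    then obtain q where "asc_word N q" "word_perm N q = w" "length q < length u" using u(2) by blast
    then show ?thesis using asc_word_unique(1)[of r q] r by simp
  qed
  then show "reduced_word N w r"
    using r asc_word_is_word[of r] by (simp add: reduced_word_def)
qed

section \<open>Words give affine permutations\<close>

lemma sum_skew_aff_swap:
  assumes "skew N w"
  shows "(\<Sum>j = 1..int N. w (aff_swap N a j)) = (\<Sum>j = 1..int N. w j)"
proof -
  \<comment> \<open>The representatives of a and a + 1 in {1..N}. If p = N, then q = 1 and the swap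
    leaves the window at both ends, to N + 1 and 0; the two corrections by N cancel.\<close>
  define p where "p = (a - 1) mod int N + 1"
  define q where "q = (if p < int N then p + 1 else 1)"
  have p: "1 \<le> p" "p \<le> int N" using N_pos by (simp_all add: p_def add1_zle_eq)
  have pa: "int N dvd p - a"
    using dvd_letter[OF N_pos, of "a - 1"] by (simp add: p_def int_letter[OF N_pos] algebra_simps)
  have q: "1 \<le> q" "q \<le> int N" using p N_pos by (simp_all add: q_def)
  have qa: "int N dvd q - a - 1"
  proof (cases "p < int N")
    case False
    then have "int N dvd int N - a" using p pa by simp
    then show ?thesis using False dvd_diff[of "int N" "int N - a" "int N"] by (simp add: q_def)
  qed (use pa in \<open>simp add: q_def\<close>)
  have "p \<noteq> q" using N3 by (simp add: q_def)
  have sp: "aff_swap N a p = p + 1" using pa by (simp add: aff_swap_def)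
  have sq: "aff_swap N a q = q - 1"
    using qa not_dvd_shift[OF qa, of 1] by (simp add: aff_swap_def)
  have fixed: "aff_swap N a j = j" if "j \<in> {1..int N} - {p, q}" for j
  proof -
    have "\<not> int N dvd j - a"
      using dvd_close[OF _ pa, of "j - a"] that p by (auto simp: abs_less_iff)
    moreover have "\<not> int N dvd j - a - 1"
      using dvd_close[OF _ qa, of "j - a - 1"] that q by (auto simp: abs_less_iff)
    ultimately show ?thesis by (simp add: aff_swap_def)
  qed
  have pq: "w (aff_swap N a p) + w (aff_swap N a q) = w p + w q"
  proof (cases "p < int N")
    case False
    then have "p = int N" "q = 1" using p by (simp_all add: q_def)
    then show ?thesis
      using sp sq skew_dvd[OF assms, of "1 + int N" 1] skew_dvd[OF assms, of "int N" 0]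
      by (simp add: algebra_simps)
  qed (simp add: sp sq, simp add: q_def)
  have "(\<Sum>j = 1..int N. w (aff_swap N a j) - w j) = (\<Sum>j\<in>{p, q}. w (aff_swap N a j) - w j)"
    by (rule sum.mono_neutral_right) (use p q fixed in auto)
  also have "\<dots> = 0" using pq \<open>p \<noteq> q\<close> by simp
  finally show ?thesis by (simp add: sum_subtractf)
qed

lemma affine_perm_word_perm:
  assumes "is_word N u" shows "affine_perm N (word_perm N u)"
proof -
  have base: "(\<Sum>j = 1..int n. j) = int n * (int n + 1) div 2" for n
  proof (induction n)
    case (Suc n)
    have "{1..int (Suc n)} = insert (int n + 1) {1..int n}" by auto
    then have "(\<Sum>j = 1..int (Suc n). j) = int n + 1 + int n * (int n + 1) div 2"
      using Suc by simp
    also have "\<dots> = int (Suc n) * (int (Suc n) + 1) div 2"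
      by (simp add: algebra_simps)
    finally show ?case .
  qed simp
  have "(\<Sum>j = 1..int N. word_perm N u j) = int N * (int N + 1) div 2"
    using assms
  proof (induction u rule: word_induct)
    case Nil
    show ?case using base[of N] by (simp add: word_perm_Nil)
  next
    case (snoc u a)
    then show ?case by (simp add: word_perm_snoc sum_skew_aff_swap skew_word_perm)
  qed
  then show ?thesis
    using bij_word_perm[OF assms] skew_word_perm[OF assms] by (simp add: affine_perm_def skew_def)
qed

section \<open>Recovering an avoiding permutation from its suffix minima\<close>

lemma suffix_min_at_jump:
  assumes "suffix_min w f" "f i < f (i + 1)" shows "w i = f i"
proof -
  obtain k where k: "k \<ge> i" "w k = f i" using assms(1) unfolding suffix_min_def by blast
  have "\<not> i + 1 \<le> k" using assms k(2) unfolding suffix_min_def by fastforce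
  then show ?thesis using k by (cases "k = i") auto
qed

text \<open>At a non-jump j the minimum is also attained at some k > j, so w(k) < w(j). A larger
  value before j would complete a [321] pattern.\<close>

lemma avoids_321_mono_off_jumps:
  assumes "suffix_min w f" "mono f" "inj w" "avoids_321 w" "\<not> f i < f (i + 1)" "\<not> f j < f (j + 1)"
  shows "w i < w j \<longleftrightarrow> i < j"
proof -
  have less: "w i < w j" if "i < j" "\<not> f j < f (j + 1)" for i j
  proof (rule ccontr)
    assume "\<not> w i < w j"
    then have ij: "w j < w i" using that(1) assms(3) by (metis inj_eq less_irrefl linorder_neqE)
    have "f j = f (j + 1)" using that(2) assms(2) by (metis monoD le_less zless_add1_eq less_imp_le)
    moreover obtain k where k: "k \<ge> j + 1" "w k = f (j + 1)"
      using assms(1) unfolding suffix_min_def by blast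
    moreover have "f j \<le> w j" using assms(1) unfolding suffix_min_def by blast
    moreover have "w k \<noteq> w j" using k(1) assms(3) by (simp add: inj_eq)
    ultimately have "w k < w j" "j < k" by simp_all
    then show False using ij that(1) assms(4) unfolding avoids_321_def by blast
  qed
  from less[of i j] less[of j i] assms(5,6) show ?thesis
    by (metis less_asym less_irrefl linorder_neqE)
qed

text \<open>If w is below w' at one non-jump i but not at another, choose by periodicity the
  second one k beyond i. The values of both permutations at the non-jumps in [i, k] fill the
  intervals [w(i), w(k)] and [w'(i), w'(k)] minus the values of f at jumps; the second interval is
  properly contained in the first, yet the number of positions is the same.\<close>
lemma avoids_321_less_off_jumps:
  assumes f: "mono f" "skew N f"
    and w: "suffix_min w f" "bij w" "skew N w" "avoids_321 w"
    and w': "suffix_min w' f" "bij w'" "skew N w'" "avoids_321 w'"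
    and i: "\<not> f i < f (i + 1)" "w i < w' i" and j: "\<not> f j < f (j + 1)"
  shows "w j < w' j"
proof (rule ccontr)
  assume "\<not> w j < w' j"
  \<comment> \<open>Chosen so that m N >= m >= i - j, which puts the translate k of j at or beyond
    i.\<close>
  define m where "m = \<bar>i\<bar> + \<bar>j\<bar>"
  define k where "k = j + m * int N"
  have "m \<le> m * int N"
    using mult_left_mono[of 1 "int N" m] N_pos by (simp add: m_def)
  then have "i \<le> k" unfolding k_def using m_def by linarith
  have k: "\<not> f k < f (k + 1)" "w' k \<le> w k"
    using skew_add_mult[OF f(2), of j m] skew_add_mult[OF f(2), of "j + 1" m]
      skew_add_mult[OF w(3)] skew_add_mult[OF w'(3)] j \<open>\<not> w j < w' j\<close>
    by (simp_all add: k_def algebra_simps)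
  define Q where "Q = {l. \<not> f l < f (l + 1)}"
  \<comment> \<open>Values in the interval that are not taken at jumps come from non-jumps, and
    monotonicity there confines their positions to [i, k].\<close>
  have img: "v ` (Q \<inter> {i..k}) = {v i..v k} - f ` (- Q)"
    if v: "suffix_min v f" "bij v" "avoids_321 v" for v
  proof -
    have less: "v l < v m \<longleftrightarrow> l < m" if "l \<in> Q" "m \<in> Q" for l m
      using avoids_321_mono_off_jumps[OF v(1) f(1) bij_is_inj[OF v(2)] v(3)] that by (simp add: Q_def)
    have jump: "v l = f l" if "l \<notin> Q" for l
      using suffix_min_at_jump[OF v(1)] that by (simp add: Q_def)
    have iQ: "i \<in> Q" and kQ: "k \<in> Q" using i k by (simp_all add: Q_def)
    show ?thesis
    proof (intro equalityI subsetI)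
      fix y assume "y \<in> v ` (Q \<inter> {i..k})"
      then obtain l where l: "y = v l" "l \<in> Q" "i \<le> l" "l \<le> k" by auto
      have "v l \<noteq> f m" if "m \<notin> Q" for m
        using jump[OF that] l(2) that bij_is_inj[OF v(2)] by (metis inj_eq)
      then show "y \<in> {v i..v k} - f ` (- Q)"
        using l less[OF l(2) iQ] less[OF kQ l(2)] by auto
    next
      fix y assume y: "y \<in> {v i..v k} - f ` (- Q)"
      obtain l where l: "y = v l" using v(2) by (metis bij_pointE)
      have lQ: "l \<in> Q" using y l jump by auto
      then show "y \<in> v ` (Q \<inter> {i..k})"
        using y l less[OF lQ iQ] less[OF kQ lQ] by auto
    qed
  qed
  have card: "card (v ` (Q \<inter> {i..k})) = card (Q \<inter> {i..k})" if "bij v" for v :: "int \<Rightarrow> int"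
    by (rule card_image) (use that in \<open>auto simp: bij_def intro: inj_on_subset\<close>)
  have "w' ` (Q \<inter> {i..k}) \<subset> w ` (Q \<inter> {i..k})"
  proof
    show "w' ` (Q \<inter> {i..k}) \<subseteq> w ` (Q \<inter> {i..k})"
      unfolding img[OF w(1,2,4)] img[OF w'(1,2,4)] using i k by auto
    have "w i \<in> w ` (Q \<inter> {i..k})" using i \<open>i \<le> k\<close> by (auto simp: Q_def)
    moreover have "w i \<notin> w' ` (Q \<inter> {i..k})"
      unfolding img[OF w'(1,2,4)] using i by auto
    ultimately show "w' ` (Q \<inter> {i..k}) \<noteq> w ` (Q \<inter> {i..k})" by metis
  qed
  then have "card (w' ` (Q \<inter> {i..k})) < card (w ` (Q \<inter> {i..k}))"
    by (intro psubset_card_mono) auto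
  then show False using card w(2) w'(2) by simp
qed

text \<open>Both permutations equal f at jumps. One strict inequality at a non-jump spreads to all
  of them, so the sums over a period would differ although both are prescribed.\<close>

lemma suffix_min_le:
  assumes f: "mono f" "skew N f"
    and w: "suffix_min w f" "affine_perm N w" "avoids_321 w"
    and w': "suffix_min w' f" "affine_perm N w'" "avoids_321 w'"
  shows "w' i \<le> w i"
proof (rule ccontr)
  assume "\<not> w' i \<le> w i"
  then have lt: "w i < w' i" by simp
  have b: "bij w" "skew N w" "bij w'" "skew N w'"
    using w(2) w'(2) by (simp_all add: affine_perm_def skew_def)
  have i: "\<not> f i < f (i + 1)"
    using lt suffix_min_at_jump[OF w(1)] suffix_min_at_jump[OF w'(1)] by fastforce
  have less: "w j < w' j" if "\<not> f j < f (j + 1)" for j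
    using avoids_321_less_off_jumps[OF f w(1) b(1,2) w(3) w'(1) b(3,4) w'(3) i lt that] .
  have le: "w j \<le> w' j" for j
    using less[of j] suffix_min_at_jump[OF w(1), of j] suffix_min_at_jump[OF w'(1), of j] by fastforce
  define j where "j = (i - 1) mod int N + 1"
  have j: "j \<in> {1..int N}" using N_pos by (simp add: j_def add1_zle_eq)
  have "int N dvd j - i"
    using dvd_letter[OF N_pos, of "i - 1"] by (simp add: j_def int_letter[OF N_pos] algebra_simps)
  then have "w j < w' j" using skew_dvd[OF b(2)] skew_dvd[OF b(4)] lt by simp
  then have "sum w {1..int N} < sum w' {1..int N}"
    using le j by (intro sum_strict_mono_ex1) auto
  then show False using w(2) w'(2) by (simp add: affine_perm_def)
qed

lemma suffix_min_unique:
  assumes "mono f" "skew N f" "suffix_min w f" "affine_perm N w" "avoids_321 w"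
    and "suffix_min w' f" "affine_perm N w'" "avoids_321 w'"
  shows "w = w'"
  using suffix_min_le[OF assms] suffix_min_le[OF assms(1,2,6-8,3-5)] by (intro ext antisym) auto

section \<open>The kernel of the action by functions\<close>

lemma asc_word_avoiding_unique:
  assumes "asc_word N r" "avoids_321 (word_perm N r)" "asc_word N q" "avoids_321 (word_perm N q)"
    and "word_ndpf N r = word_ndpf N q"
  shows "word_perm N r = word_perm N q"
  by (rule suffix_min_unique[of "word_ndpf N r"])
    (use assms suffix_min_asc_word affine_perm_word_perm asc_word_is_word
      mono_word_ndpf skew_word_ndpf in metis)+

text \<open>For injectivity both words are replaced by avoiding ones: the function determines the
  permutation, and the permutation determines the class.\<close>

lemma word_ndpf_eq_iff:
  assumes "is_word N u" "is_word N v"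
  shows "word_ndpf N u = word_ndpf N v \<longleftrightarrow> quot_cong N u v"
proof
  assume eq: "word_ndpf N u = word_ndpf N v"
  obtain r q where r: "asc_word N r" "avoids_321 (word_perm N r)" "quot_cong N r u"
    and q: "asc_word N q" "avoids_321 (word_perm N q)" "quot_cong N q v"
    using quot_cong_avoiding assms by meson
  have "word_ndpf N r = word_ndpf N q"
    using eq quot_cong_word_ndpf[OF r(3)] quot_cong_word_ndpf[OF q(3)] by simp
  then have "quot_cong N r q"
    using asc_word_unique(2)[OF r(1) q(1)] asc_word_avoiding_unique[OF r(1,2) q(1,2)] by blast
  then show "quot_cong N u v"
    using r(3) q(3) cong_closure.sym cong_closure.trans by metis
qed (rule quot_cong_word_ndpf)

section \<open>The image of the action by functions\<close>

lemma word_ndpf_in_NDPF: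
  assumes "is_word N u" shows "word_ndpf N u \<in> NDPF N"
proof -
  have "word_ndpf N u \<noteq> (\<lambda>i. i - t)" if "t \<noteq> 0" for t
    using assms
  proof (induction u rule: word_induct)
    case Nil
    show ?case
    proof
      assume "word_ndpf N [] = (\<lambda>i. i - t)"
      then have "word_ndpf N [] 0 = 0 - t" by (rule fun_cong)
      then show False using that by (simp add: word_ndpf_Nil)
    qed
  next
    case (snoc u a)
    \<comment> \<open>A function ending in the letter a identifies a and a + 1, which no shift
      does.\<close>
    have "word_ndpf N (u @ [L a]) a = word_ndpf N (u @ [L a]) (a + 1)"
      using not_dvd_shift[of 0 "-1"] by (simp add: word_ndpf_snoc lower_def)
    then show ?case by auto
  qed
  then show ?thesis
    using word_ndpf_le mono_word_ndpf[of u] skew_word_ndpf[of u]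
    by (auto simp: NDPF_def mono_def skew_def)
qed

text \<open>A flat step followed by a jump is where a last letter i can be split off. Without flat
  steps, N increments of at least 1 add up to N, so f is a shift; without a later jump, f is
  eventually constant, against periodicity.\<close>

lemma NDPF_jump:
  assumes "f \<in> NDPF N" "f \<noteq> id"
  obtains i where "f i = f (i + 1)" "f (i + 1) < f (i + 2)"
proof -
  have mono: "i \<le> j \<Longrightarrow> f i \<le> f j" and per: "f (i + int N) = f i + int N" for i j
    using assms(1) by (auto simp: NDPF_def)
  have "\<exists>i. f i = f (i + 1)"
  proof (rule ccontr)
    assume "\<nexists>i. f i = f (i + 1)"
    have step: "f i + 1 \<le> f (i + 1)" for i
    proof -
      have "f i \<noteq> f (i + 1)" using \<open>\<nexists>i. f i = f (i + 1)\<close> by blast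
      then show ?thesis using mono[of i "i + 1"] by simp
    qed
    have grow: "f i + int n \<le> f (i + int n)" for i n
    proof (induction n)
      case (Suc n)
      then show ?case using step[of "i + int n"] by (simp add: algebra_simps)
    qed simp
    have one: "f (i + 1) = f i + 1" for i
      using step[of i] grow[of "i + 1" "N - 1"] per[of i] N3 by (simp add: of_nat_diff)
    have lin: "f i = i + f 0" for i
    proof (induction i rule: int_induct[of _ 0])
      case (step2 i)
      then show ?case using one[of "i - 1"] by simp
    qed (simp_all add: one)
    have shift: "f = (\<lambda>i. i - (- f 0))"
      unfolding diff_minus_eq_add by (rule ext) (rule lin)
    have "f 0 \<noteq> 0"
    proof
      assume "f 0 = 0"
      then have "f i = id i" for i using lin[of i] by simp
      then show False using assms(2) by (simp add: fun_eq_iff)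
    qed
    moreover have "\<not> (\<exists>t. t \<noteq> 0 \<and> f = (\<lambda>i. i - t))" using assms(1) by (simp add: NDPF_def)
    ultimately show False using shift neg_equal_0_iff_equal[of "f 0"] by blast
  qed
  then obtain i where i: "f i = f (i + 1)" by (elim exE)
  have "\<exists>n. f (i + 1 + int n) < f (i + 2 + int n)"
  proof (rule ccontr)
    assume neg: "\<nexists>n. f (i + 1 + int n) < f (i + 2 + int n)"
    have "f (i + 1 + int n) \<le> f (i + 1)" for n
    proof (induction n)
      case (Suc n)
      have "\<not> f (i + 1 + int n) < f (i + 2 + int n)" using neg by blast
      then show ?case using Suc by (simp add: algebra_simps)
    qed simp
    from this[of N] show False using per[of "i + 1"] N_pos by simp
  qed
  from this[unfolded exists_least_iff[of "\<lambda>n. f (i + 1 + int n) < f (i + 2 + int n)"]]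
  obtain n where n: "f (i + 1 + int n) < f (i + 2 + int n)"
    "\<And>m. m < n \<Longrightarrow> \<not> f (i + 1 + int m) < f (i + 2 + int m)"
    by (elim exE conjE) simp
  have "f (i + int n) = f (i + int n + 1)"
  proof (cases n)
    case (Suc m)
    then show ?thesis using n(2)[of m] mono[of "i + 1 + int m" "i + 2 + int m"]
      by (simp add: algebra_simps)
  qed (use i in simp)
  then show ?thesis using that[of "i + int n"] n(1) by (simp add: algebra_simps)
qed

lemma NDPF_word:
  assumes "f \<in> NDPF N" shows "\<exists>u. is_word N u \<and> word_ndpf N u = f"
  using assms
proof (induction "nat (\<Sum>j = 1..int N. j - f j)" arbitrary: f rule: less_induct)
  case less
  show ?case
  proof (cases "f = id")
    case True
    then show ?thesis using is_word_Nil word_ndpf_Nil by blast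
  next
    case False
    have mono: "i \<le> j \<Longrightarrow> f i \<le> f j" and per: "f (i + int N) = f i + int N" and reg: "f i \<le> i" for i j
      using less.prems by (auto simp: NDPF_def)
    have sf: "skew N f" using per by (simp add: skew_def)
    obtain i where i: "f i = f (i + 1)" "f (i + 1) < f (i + 2)"
      using NDPF_jump[OF less.prems False] .
    \<comment> \<open>On the class of i + 1, f is raised as far as order and regressivity permit.
      The flat step gives f = g \<circ> \<open>lower N i\<close>; the jump, together with f(i + 1) =
      f(i) <= i, makes the increase strict, so the measure drops.\<close>
    define g where "g k = (if int N dvd k - i - 1 then min (f (k + 1)) k else f k)" for k
    have fg: "f k \<le> g k" for k using mono[of k "k + 1"] reg[of k] by (simp add: g_def)
    have gr: "g k \<le> k" for k using reg[of k] by (simp add: g_def)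
    have gp: "g (k + int N) = g k + int N" for k
      using per[of k] per[of "k + 1"] dvd_add_self'[of N k i] by (simp add: g_def min_def algebra_simps)
    have g1: "g k \<le> f (k + 1)" for k using mono[of k "k + 1"] by (simp add: g_def)
    have gm: "g k \<le> g l" if "k \<le> l" for k l
    proof (cases "k = l")
      case False
      then show ?thesis using that g1[of k] mono[of "k + 1" l] fg[of l] by simp
    qed simp
    have up: "f k < g k" if "int N dvd k - i - 1" for k
      using that skew_dvd[OF sf, of k "i + 1"] skew_dvd[OF sf, of "k + 1" "i + 2"] i reg[of i]
      by (simp add: g_def algebra_simps)
    have fgi: "f = g \<circ> lower N i"
    proof
      fix k
      show "f k = (g \<circ> lower N i) k"
      proof (cases "int N dvd k - i - 1")
        case True
        then have "\<not> int N dvd k - 1 - i - 1" using not_dvd_shift[OF True, of "-1"] by (simp add: algebra_simps)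
        moreover have "f (k - 1) = f k"
          using i True skew_dvd[OF sf, of k "i + 1"] skew_dvd[OF sf, of "k - 1" i]
          by (simp add: algebra_simps)
        ultimately show ?thesis using True by (simp add: lower_def g_def)
      qed (simp add: lower_def g_def)
    qed
    \<comment> \<open>The value g(i + 1) is either g(i + 2), impossible for a shift, or i + 1, which
      forces t = 0.\<close>
    have "g \<noteq> (\<lambda>k. k - t)" if "t \<noteq> 0" for t
    proof
      assume g: "g = (\<lambda>k. k - t)"
      have "\<not> int N dvd 1" using not_dvd_shift[of 0 1] by simp
      then have "g (i + 2) = f (i + 2)" by (simp add: g_def)
      moreover have "g (i + 1) = min (f (i + 2)) (i + 1)" by (simp add: g_def algebra_simps)
      ultimately show False using g gr[of 0] that by (simp add: min_def split: if_splits)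
    qed
    then have gN: "g \<in> NDPF N" using gr gm gp by (auto simp: NDPF_def)
    define j where "j = i mod int N + 1"
    have j: "j \<in> {1..int N}" using N_pos by (simp add: j_def add1_zle_eq)
    have "int N dvd j - i - 1"
      using dvd_letter[OF N_pos, of i] by (simp add: j_def int_letter[OF N_pos])
    then have "(\<Sum>j = 1..int N. j - g j) < (\<Sum>j = 1..int N. j - f j)"
      using up[of j] j fg by (intro sum_strict_mono_ex1) (auto intro!: bexI[of _ j])
    moreover have "0 \<le> (\<Sum>j = 1..int N. j - g j)" using gr by (intro sum_nonneg) simp
    ultimately obtain u where u: "is_word N u" "word_ndpf N u = g"
      using less.hyps[OF _ gN] by auto
    then have "word_ndpf N (u @ [L i]) = f" by (simp add: word_ndpf_snoc fgi)
    then show ?thesis using u(1) is_word_snoc by blast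
  qed
qed

lemma unique_avoiding_in_class:
  assumes "is_word N u"
  shows "\<exists>!w. affine_perm N w \<and> avoids_321 w \<and> (\<exists>r. reduced_word N w r \<and> quot_cong N r u)"
proof -
  obtain r where r: "asc_word N r" "avoids_321 (word_perm N r)" "quot_cong N r u"
    using quot_cong_avoiding[OF assms] by blast
  show ?thesis
  proof (rule ex1I[of _ "word_perm N r"])
    show "affine_perm N (word_perm N r) \<and> avoids_321 (word_perm N r) \<and>
        (\<exists>q. reduced_word N (word_perm N r) q \<and> quot_cong N q u)"
      using r affine_perm_word_perm asc_word_is_word by (auto simp: reduced_word_iff_asc_word)
  next
    fix w assume "affine_perm N w \<and> avoids_321 w \<and> (\<exists>q. reduced_word N w q \<and> quot_cong N q u)"
    then obtain q where q: "asc_word N q" "word_perm N q = w" "avoids_321 w" "quot_cong N q u"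
      by (auto simp: reduced_word_iff_asc_word)
    have "word_ndpf N q = word_ndpf N r"
      using quot_cong_word_ndpf[OF q(4)] quot_cong_word_ndpf[OF r(3)] by simp
    then show "w = word_perm N r"
      using asc_word_avoiding_unique[OF q(1) _ r(1,2)] q(2,3) by simp
  qed
qed

end

section \<open>J-triviality\<close>

lemma J_trivial_NDPF: "J_trivial (NDPF N)"
proof -
  let ?M = "NDPF N"
  have id: "id \<in> ?M" by (auto simp: NDPF_def fun_eq_iff)
  \<comment> \<open>As the identity lies in the monoid, f = a g b. Regressivity of a and b and
    monotonicity of g bound f by g pointwise; the reverse inclusion gives equality.\<close>
  have le: "f i \<le> g i"
    if sub: "{a \<circ> f \<circ> b | a b. a \<in> ?M \<and> b \<in> ?M} \<subseteq> {a \<circ> g \<circ> b | a b. a \<in> ?M \<and> b \<in> ?M}"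
      and g: "g \<in> ?M"
    for f g i
  proof -
    have "id \<circ> f \<circ> id \<in> {a \<circ> f \<circ> b | a b. a \<in> ?M \<and> b \<in> ?M}" using id by blast
    then have "f \<in> {a \<circ> g \<circ> b | a b. a \<in> ?M \<and> b \<in> ?M}" using subsetD[OF sub] by simp
    then obtain a b where ab: "f = a \<circ> g \<circ> b" "a \<in> ?M" "b \<in> ?M" by blast
    have "f i = a (g (b i))" using ab(1) by simp
    also have "\<dots> \<le> g (b i)" using ab(2) by (simp add: NDPF_def)
    also have "\<dots> \<le> g i" using ab(3) g by (simp add: NDPF_def)
    finally show ?thesis .
  qed
  show ?thesis unfolding J_trivial_def
  proof (intro ballI impI ext)
    fix f g i
    assume "f \<in> ?M" "g \<in> ?M"
      and eq: "{a \<circ> f \<circ> b | a b. a \<in> ?M \<and> b \<in> ?M} = {a \<circ> g \<circ> b | a b. a \<in> ?M \<and> b \<in> ?M}"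
    then show "f i = g i"
      by (intro antisym le[OF equalityD1[OF eq]] le[OF equalityD2[OF eq]])
  qed
qed

theorem mainTheorem4:
  fixes N :: nat
  assumes "N \<ge> 3"
  shows "J_trivial (NDPF N)
    \<and> (\<exists>F :: nat list \<Rightarrow> (int \<Rightarrow> int).
          (\<forall>u. is_word N u \<longrightarrow> F u \<in> NDPF N)
        \<and> (\<forall>f\<in>NDPF N. \<exists>u. is_word N u \<and> F u = f)
        \<and> (\<forall>u v. is_word N u \<longrightarrow> is_word N v \<longrightarrow> (F u = F v \<longleftrightarrow> quot_cong N u v))
        \<and> (\<forall>u v. is_word N u \<longrightarrow> is_word N v \<longrightarrow> F (u @ v) = F u \<circ> F v)
        \<and> F [] = id)
    \<and> (\<forall>u. is_word N u \<longrightarrow>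
          (\<exists>!w. affine_perm N w \<and> avoids_321 w \<and>
                (\<exists>r. reduced_word N w r \<and> quot_cong N r u)))"
proof (intro conjI exI[of _ "word_ndpf N"] allI ballI impI)
  show "J_trivial (NDPF N)" by (rule J_trivial_NDPF)
  show "word_ndpf N u \<in> NDPF N" if "is_word N u" for u
    by (rule word_ndpf_in_NDPF[OF assms that])
  show "\<exists>u. is_word N u \<and> word_ndpf N u = f" if "f \<in> NDPF N" for f
    by (rule NDPF_word[OF assms that])
  show "word_ndpf N u = word_ndpf N v \<longleftrightarrow> quot_cong N u v" if "is_word N u" "is_word N v" for u v
    by (rule word_ndpf_eq_iff[OF assms that])
  show "word_ndpf N (u @ v) = word_ndpf N u \<circ> word_ndpf N v" for u v
    by (rule word_ndpf_append)
  show "word_ndpf N [] = id" by (rule word_ndpf_Nil)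
  show "\<exists>!w. affine_perm N w \<and> avoids_321 w \<and> (\<exists>r. reduced_word N w r \<and> quot_cong N r u)"
    if "is_word N u" for u
    by (rule unique_avoiding_in_class[OF assms that])
qed

end
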